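(* Let $p\ge5$ be a prime with $\left(\frac{-10}{p}\right)=-1$. Then for all integers $\alpha\ge1$ and $n\ge0$, \[ b_5\!\left(4 p^{2\alpha}n+\frac{(24i+7p)p^{2\alpha-1}-1}{6}\right)\equiv 0 \pmod 2 \] for each $i=1,2,\ldots,p-1$.
   Context: For a positive integer $\ell$, $b_\ell(n)$ denotes the number of partitions of $n$ having no part divisible by $\ell$. $\left(\frac{a}{p}\right)$ is the Legendre symbol. *)

theory Defs
  imports "HOL-Library.Multiset" "HOL-Number_Theory.Number_Theory"
begin

definition b :: "nat \<Rightarrow> nat \<Rightarrow> nat" where
  "b ell n = card {M :: nat multiset. (\<forall>x\<in>#M. 0 < x \<and> \<not> ell dvd x) \<and> sum_mset M = n}"

end

theory Submission
  imports Defs "HOL-Library.Z2" "HOL-Library.Disjoint_Sets"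
    "HOL-Computational_Algebra.Formal_Power_Series"
begin

text \<open>
  Work in the ring of formal power series over the field with two elements, and write
  \<open>f d\<close> for the product of all \<open>1 - X ^ (d * j)\<close> with \<open>j \<ge> 1\<close>. The generating function \<open>B\<close> of the
  5-regular partitions satisfies \<open>B * f 1 = f 5\<close>. The crucial identity is
  \<open>f 1 * f 5 = f 1 ^ 6 + X * f 5 ^ 6\<close>: by the Jacobi triple product its terms are theta series and products of two theta series,
  and comparing coefficients amounts to the parity of the number of solutions of
  \<open>x * (x + 1) + y * (y + 1) = 2 * n\<close> with \<open>x \<equiv> 2 * y\<close> modulo 5, which is settled by involutions and,
  for \<open>n \<equiv> 1\<close> modulo 5, by a descent from \<open>n\<close> to \<open>(n - 1) / 5\<close>. Hence
  \<open>B = f 1 ^ 4 + X * f 5 ^ 4 * B ^ 2\<close>; substituting this equation into itself and using that fourth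
  powers only involve exponents divisible by 4 shows that \<open>b 5 (4 * n + 1)\<close> has the parity of the
  \<open>n\<close>-th coefficient of \<open>f 5 * f 2\<close>. By the pentagonal number theorem that coefficient vanishes
  unless \<open>24 * n + 7 = 5 * x ^ 2 + 2 * y ^ 2\<close> for some integers, and then every prime modulo which
  \<open>- 10\<close> is a non-residue divides \<open>24 * n + 7\<close> to an even power.
\<close>

unbundle fps_syntax

(* As simp rules these turn sums and products in the field into bit operations, out of reach of
  the ring lemmas. *)
declare add_bit_eq_xor [simp del] mult_bit_eq_and [simp del]

section \<open>Truncated equality and infinite products of power series\<close>

text \<open>This is congruence modulo \<open>X ^ (n + 1)\<close>. It lets infinite products be
  handled through finite ones without any topology on power series.\<close>

definition fps_agree :: "nat \<Rightarrow> 'a::comm_ring_1 fps \<Rightarrow> 'a fps \<Rightarrow> bool" where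
  "fps_agree n f g \<longleftrightarrow> (\<forall>i\<le>n. f $ i = g $ i)"

lemma fps_agree_refl [simp]: "fps_agree n f f"
  by (simp add: fps_agree_def)

lemma fps_agree_sym: "fps_agree n f g \<Longrightarrow> fps_agree n g f"
  by (simp add: fps_agree_def)

lemma fps_agree_trans [trans]: "fps_agree n f g \<Longrightarrow> fps_agree n g h \<Longrightarrow> fps_agree n f h"
  by (simp add: fps_agree_def)

lemma fps_agree_mult:
  "fps_agree n f f' \<Longrightarrow> fps_agree n g g' \<Longrightarrow> fps_agree n (f * g) (f' * g')"
  by (auto simp: fps_agree_def fps_mult_nth intro!: sum.cong)

lemma fps_agree_sum:
  "(\<And>i. i \<in> A \<Longrightarrow> fps_agree n (f i) (g i)) \<Longrightarrow> fps_agree n (\<Sum>i\<in>A. f i) (\<Sum>i\<in>A. g i)"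
  by (auto simp: fps_agree_def fps_sum_nth intro!: sum.cong)

lemma fps_agree_X_power_mult: "n < k \<Longrightarrow> fps_agree n (fps_X ^ k * f) 0"
  by (simp add: fps_agree_def fps_X_power_mult_nth)

lemma fps_eq_iff_agree: "f = g \<longleftrightarrow> (\<forall>n. fps_agree n f g)"
  by (auto simp: fps_agree_def fps_eq_iff)

text \<open>A series with non-zero constant term is a unit, and multiplying by its inverse respects
  truncation.\<close>

lemma fps_agree_cancel:
  fixes c :: "'a::field fps"
  assumes "c $ 0 \<noteq> 0" and "fps_agree n (f * c) (g * c)"
  shows "fps_agree n f g"
proof -
  have "fps_agree n (f * c * inverse c) (g * c * inverse c)"
    by (intro fps_agree_mult assms fps_agree_refl)
  moreover have "c * inverse c = 1"
    using assms(1) by (simp add: inverse_mult_eq_1')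
  ultimately show ?thesis
    by (simp add: mult.assoc)
qed

text \<open>The possibly infinite product of \<open>1 + X ^ j\<close> over the positive
  \<open>j\<close> in \<open>S\<close>: factors with \<open>j > n\<close> cannot affect coefficient
  \<open>n\<close>. Over two elements the signs vanish, so this is also the product of all
  \<open>1 - X ^ j\<close>.\<close>

definition distinct_prod :: "nat set \<Rightarrow> bit fps" where
  "distinct_prod S = Abs_fps (\<lambda>n. (\<Prod>j\<in>S \<inter> {1..n}. 1 + fps_X ^ j) $ n)"

text \<open>Each additional factor is 1 modulo \<open>X ^ (n + 1)\<close>.\<close>

lemma fps_agree_prod_subset:
  assumes "finite F" "G \<subseteq> F" "\<And>j. j \<in> F - G \<Longrightarrow> n < j"
  shows "fps_agree n (\<Prod>j\<in>F. 1 + fps_X ^ j :: 'a::comm_ring_1 fps) (\<Prod>j\<in>G. 1 + fps_X ^ j)"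
proof -
  have "fps_agree n (\<Prod>j\<in>H. 1 + fps_X ^ j :: 'a fps) 1" if "finite H" "\<forall>j\<in>H. n < j" for H
    using that
  proof (induction H rule: finite_induct)
    case (insert j H)
    have "fps_agree n (1 + fps_X ^ j :: 'a fps) 1"
      using insert.prems by (auto simp: fps_agree_def fps_X_power_nth)
    with insert have "fps_agree n ((1 + fps_X ^ j) * (\<Prod>j\<in>H. 1 + fps_X ^ j) :: 'a fps) (1 * 1)"
      by (intro fps_agree_mult) auto
    with insert show ?case by simp
  qed simp
  hence "fps_agree n ((\<Prod>j\<in>F - G. 1 + fps_X ^ j) * (\<Prod>j\<in>G. 1 + fps_X ^ j) :: 'a fps)
      (1 * (\<Prod>j\<in>G. 1 + fps_X ^ j))"
    using assms by (intro fps_agree_mult) auto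
  moreover have "(\<Prod>j\<in>F - G. 1 + fps_X ^ j) * (\<Prod>j\<in>G. 1 + fps_X ^ j) =
      (\<Prod>j\<in>F. 1 + fps_X ^ j :: 'a fps)"
    using assms by (metis prod.subset_diff)
  ultimately show ?thesis by simp
qed

text \<open>The freedom in choosing \<open>F\<close> matters later: finite products indexed by
  \<open>j < N\<close> usually reach beyond exponent \<open>n\<close>.\<close>

lemma distinct_prod_agree:
  assumes "finite F" "S \<inter> {1..n} \<subseteq> F" "F \<subseteq> S" "0 \<notin> F"
  shows "fps_agree n (distinct_prod S) (\<Prod>j\<in>F. 1 + fps_X ^ j)"
  unfolding fps_agree_def
proof (intro allI impI)
  fix i assume "i \<le> n"
  have "fps_agree i (\<Prod>j\<in>F. 1 + fps_X ^ j :: bit fps) (\<Prod>j\<in>S \<inter> {1..i}. 1 + fps_X ^ j)"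
  proof (rule fps_agree_prod_subset)
    show "S \<inter> {1..i} \<subseteq> F" using assms \<open>i \<le> n\<close> by auto
    fix j assume "j \<in> F - S \<inter> {1..i}"
    with assms show "i < j" by (metis DiffE IntI One_nat_def Suc_leI atLeastAtMost_iff gr0I leI subsetD)
  qed (use assms in auto)
  thus "distinct_prod S $ i = (\<Prod>j\<in>F. 1 + fps_X ^ j) $ i"
    by (simp add: fps_agree_def distinct_prod_def)
qed

lemma distinct_prod_Un:
  assumes "S \<inter> T = {}"
  shows "distinct_prod (S \<union> T) = distinct_prod S * distinct_prod T"
  unfolding fps_eq_iff_agree
proof
  fix n
  have "fps_agree n (distinct_prod (S \<union> T)) (\<Prod>j\<in>(S \<union> T) \<inter> {1..n}. 1 + fps_X ^ j)"
    by (rule distinct_prod_agree) auto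
  also have "(\<Prod>j\<in>(S \<union> T) \<inter> {1..n}. 1 + fps_X ^ j :: bit fps) =
      (\<Prod>j\<in>S \<inter> {1..n}. 1 + fps_X ^ j) * (\<Prod>j\<in>T \<inter> {1..n}. 1 + fps_X ^ j)"
    using assms by (subst prod.union_disjoint [symmetric]) (auto simp: Int_Un_distrib2)
  also have "fps_agree n \<dots> (distinct_prod S * distinct_prod T)"
    by (intro fps_agree_mult fps_agree_sym [OF distinct_prod_agree]) auto
  finally show "fps_agree n (distinct_prod (S \<union> T)) (distinct_prod S * distinct_prod T)" .
qed

lemma distinct_prod_0 [simp]: "distinct_prod S $ 0 = 1"
  by (simp add: distinct_prod_def)

lemma distinct_prod_neq_0 [simp]: "distinct_prod S \<noteq> 0"
  by (metis distinct_prod_0 fps_zero_nth zero_neq_one)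

section \<open>Arithmetic in characteristic 2\<close>

lemma add_self_bit_fps: "f + f = (0 :: bit fps)"
proof (rule fps_ext)
  fix n
  show "(f + f) $ n = 0 $ n"
    unfolding fps_add_nth fps_zero_nth by (cases "f $ n") simp_all
qed

lemma two_eq_0_bit_fps [simp]: "(2 :: bit fps) = 0"
  using add_self_bit_fps [of 1] by (simp only: one_add_one)

lemma diff_eq_add_bit_fps: "f - g = f + (g :: bit fps)"
  by (metis add_diff_cancel_right' add_self_bit_fps add.assoc add.right_neutral)

subsection \<open>Gaussian binomials and the Jacobi triple product\<close>

text \<open>Gaussian binomial coefficients, defined by the q-Pascal recurrence so that they exist in
  every commutative ring without division.\<close>

fun qbinom :: "'a::comm_ring_1 \<Rightarrow> nat \<Rightarrow> nat \<Rightarrow> 'a" where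
  "qbinom q n 0 = 1"
| "qbinom q 0 (Suc s) = 0"
| "qbinom q (Suc n) (Suc s) = qbinom q n s + q ^ Suc s * qbinom q n (Suc s)"

lemma qbinom_eq_0: "n < s \<Longrightarrow> qbinom q n s = 0"
  by (induction q n s rule: qbinom.induct) auto

lemma qbinom_self: "qbinom q n n = 1"
  by (induction n) (auto simp: qbinom_eq_0)

text \<open>Splitting off the factor \<open>j = 0\<close> leaves the same product with
  \<open>y * q\<close> for \<open>y\<close>, hence the induction with \<open>y\<close>
  arbitrary.\<close>

theorem q_binomial_theorem:
  fixes q w y :: "'a::comm_ring_1"
  shows "(\<Prod>j<n. w + y * q ^ j) = (\<Sum>s\<le>n. q ^ (s choose 2) * qbinom q n s * y ^ s * w ^ (n - s))"
proof (induction n arbitrary: y)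
  case (Suc n)
  define t where "t = (\<lambda>s. q ^ (s choose 2) * qbinom q n s * (y * q) ^ s)"
  have t0: "t s = 0" if "n < s" for s
    using that by (simp add: t_def qbinom_eq_0)
  \<comment> \<open>The q-Pascal recurrence in terms of \<open>t\<close>; the powers of
    \<open>q\<close> match because \<open>Suc s choose 2\<close> exceeds \<open>s choose 2\<close>
    by \<open>s\<close>.\<close>
  have tS: "q ^ (Suc s choose 2) * qbinom q (Suc n) (Suc s) * y ^ Suc s = t (Suc s) + y * t s" for s
  proof -
    have "Suc s choose 2 = s + (s choose 2)"
      by (simp add: numeral_2_eq_2)
    thus ?thesis
      by (simp add: t_def power_add power_mult_distrib algebra_simps)
  qed
  have "(\<Prod>j<Suc n. w + y * q ^ j) = (w + y) * (\<Prod>j<n. w + (y * q) * q ^ j)"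
    by (subst prod.lessThan_Suc_shift) (simp add: mult.assoc)
  also have "\<dots> = (w + y) * (\<Sum>s\<le>n. t s * w ^ (n - s))"
    unfolding Suc.IH t_def ..
  also have "\<dots> = (\<Sum>s\<le>n. t s * w ^ (Suc n - s)) + (\<Sum>s\<le>n. y * t s * w ^ (n - s))"
    by (simp add: distrib_left distrib_right sum.distrib sum_distrib_left Suc_diff_le mult_ac)
  also have "(\<Sum>s\<le>n. t s * w ^ (Suc n - s)) = (\<Sum>s\<le>Suc n. t s * w ^ (Suc n - s))"
    by (simp add: t0)
  also have "\<dots> = t 0 * w ^ Suc n + (\<Sum>s\<le>n. t (Suc s) * w ^ (n - s))"
    by (subst sum.atMost_Suc_shift) simp
  also have "\<dots> + (\<Sum>s\<le>n. y * t s * w ^ (n - s)) =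
      t 0 * w ^ Suc n + (\<Sum>s\<le>n. (t (Suc s) + y * t s) * w ^ (n - s))"
    by (simp add: algebra_simps sum.distrib)
  also have "\<dots> = t 0 * w ^ Suc n +
      (\<Sum>s\<le>n. q ^ (Suc s choose 2) * qbinom q (Suc n) (Suc s) * y ^ Suc s * w ^ (n - s))"
    by (simp only: tS)
  also have "\<dots> = (\<Sum>s\<le>Suc n. q ^ (s choose 2) * qbinom q (Suc n) s * y ^ s * w ^ (Suc n - s))"
    by (subst sum.atMost_Suc_shift) (simp add: t_def)
  finally show ?case .
qed (simp add: binomial_eq_0)

text \<open>The quotient formula for Gaussian binomials with denominators cleared. With
  \<open>n = s + r + 1\<close>, the recurrence reduces it to \<open>1 - q ^ (s + 1) + q ^ (s + 1) *
  (1 - q ^ (r + 1)) = 1 - q ^ (n + 1)\<close>.\<close>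

lemma qbinom_mult_prods:
  fixes q :: "'a::comm_ring_1"
  assumes "s \<le> n"
  shows "qbinom q n s * (\<Prod>j=1..s. 1 - q ^ j) * (\<Prod>j=1..n - s. 1 - q ^ j) = (\<Prod>j=1..n. 1 - q ^ j)"
  using assms
proof (induction q n s rule: qbinom.induct)
  case (3 q n s)
  define P where "P = (\<lambda>n. \<Prod>j=1..n. 1 - q ^ j)"
  have P_Suc: "P (Suc n) = P n * (1 - q ^ Suc n)" for n
    by (simp add: P_def mult.commute)
  have "qbinom q (Suc n) (Suc s) * P (Suc s) * P (n - s) = P (Suc n)"
  proof (cases "s = n")
    case True
    thus ?thesis by (simp add: qbinom_self qbinom_eq_0 P_def)
  next
    case False
    then obtain r where r: "n - s = Suc r" "n = s + Suc r"
      using "3.prems" by (metis Suc_le_mono add_diff_inverse_nat less_le_not_le not0_implies_Suc zero_less_diff le_neq_implies_less)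
    have IH1: "qbinom q n s * P s * P (Suc r) = P n"
      using "3.IH"(1) r unfolding P_def by simp
    have IH2: "qbinom q n (Suc s) * P (Suc s) * P r = P n"
      using "3.IH"(2) r unfolding P_def by simp
    have "qbinom q (Suc n) (Suc s) * P (Suc s) * P (Suc r) =
        (qbinom q n s * P s * P (Suc r)) * (1 - q ^ Suc s) +
        q ^ Suc s * (qbinom q n (Suc s) * P (Suc s) * P r) * (1 - q ^ Suc r)"
      unfolding P_Suc qbinom.simps by (simp add: algebra_simps del: power_Suc)
    also have "\<dots> = P n * (1 - q ^ Suc s + q ^ Suc s * (1 - q ^ Suc r))"
      unfolding IH1 IH2 by (simp add: algebra_simps del: power_Suc)
    also have "q ^ Suc s * (1 - q ^ Suc r) = q ^ Suc s - q ^ Suc n"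
      unfolding r(2) by (simp add: right_diff_distrib power_add)
    finally show ?thesis unfolding r(1) P_Suc by simp
  qed
  thus ?case by (simp add: P_def)
qed auto

section \<open>Theta series and the triple product modulo 2\<close>

definition residue_parts :: "nat \<Rightarrow> nat \<Rightarrow> nat set" where
  "residue_parts k r = range (\<lambda>j. k * j + r)"

text \<open>The exponent \<open>k * m * (m - 1) / 2 + a * m\<close>. For \<open>0 < a < k\<close>
  neither \<open>nat\<close> nor \<open>div\<close> loses information, as
  \<open>double_theta_exp\<close> shows.\<close>

definition theta_exp :: "nat \<Rightarrow> nat \<Rightarrow> int \<Rightarrow> nat" where
  "theta_exp k a m = nat ((int k * (m * (m - 1)) + 2 * int a * m) div 2)"

definition theta :: "nat \<Rightarrow> nat \<Rightarrow> bit fps" where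
  "theta k a = Abs_fps (\<lambda>n. of_nat (card {m. theta_exp k a m = n}))"

text \<open>One inequality provides both the non-negativity of the exponents and the finiteness of
  their fibres.\<close>

lemma theta_exp_bound:
  assumes "0 < a" "a < k"
  shows "2 * \<bar>m\<bar> \<le> int k * (m * (m - 1)) + 2 * int a * m"
proof (cases "m > 0")
  case True
  have "0 \<le> int k * (m * (m - 1))" using True by auto
  moreover have "m \<le> int a * m" using True assms by simp
  ultimately show ?thesis using True by linarith
next
  case False
  define t where "t = - m"
  have t: "m = - t" "t \<ge> 0" using False by (auto simp: t_def)
  have "t * 1 \<le> t * t" using t by (cases "t = 0") (auto intro: mult_left_mono)
  hence 1: "2 * t \<le> t * (t + 1)" by (simp add: algebra_simps)
  have "(int a + 1) * (2 * t) \<le> int k * (t * (t + 1))"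
    using assms 1 t by (intro mult_mono [of _ _ "2 * t"]) auto
  thus ?thesis using t by (simp add: algebra_simps)
qed

lemma double_theta_exp:
  assumes "0 < a" "a < k"
  shows "2 * int (theta_exp k a m) = int k * (m * (m - 1)) + 2 * int a * m"
proof -
  have "even (int k * (m * (m - 1)) + 2 * int a * m)" by auto
  thus ?thesis
    using theta_exp_bound [OF assms, of m] by (simp add: theta_exp_def)
qed

lemma abs_le_theta_exp:
  assumes "0 < a" "a < k"
  shows "\<bar>m\<bar> \<le> int (theta_exp k a m)"
  using theta_exp_bound [OF assms, of m] double_theta_exp [OF assms, of m] by linarith

lemma finite_theta_exp:
  assumes "0 < a" "a < k"
  shows "finite {m. theta_exp k a m = n}"
proof (rule finite_subset)
  show "{m. theta_exp k a m = n} \<subseteq> {- int n..int n}"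
  proof
    fix m assume "m \<in> {m. theta_exp k a m = n}"
    thus "m \<in> {- int n..int n}" using abs_le_theta_exp [OF assms, of m] by auto
  qed
qed auto

lemma prod_lessThan_add:
  fixes f :: "nat \<Rightarrow> 'a::comm_monoid_mult"
  shows "(\<Prod>j<m + n. f j) = (\<Prod>j<m. f j) * (\<Prod>j<n. f (m + j))"
  by (induction n) (auto simp: mult.assoc)

text \<open>In the q-binomial theorem with \<open>2 * N\<close> factors, the upper half gives the
  factors \<open>1 + X ^ (k * j + a)\<close> and the lower half, read backwards, those with
  \<open>k - a\<close>, up to a common power of \<open>X\<close>.\<close>

lemma finite_jacobi_triple_product:
  assumes "0 < a" "a < k"
  shows "(\<Prod>j<N. 1 + fps_X ^ (k * j + a)) * (\<Prod>j<N. 1 + fps_X ^ (k * j + (k - a))) =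
    (\<Sum>s\<le>2 * N. fps_X ^ theta_exp k a (int s - int N) * qbinom (fps_X ^ k :: bit fps) (2 * N) s)"
    (is "?L = ?R")
proof -
  let ?X = "fps_X :: bit fps"
  let ?Q = "?X ^ k"
  \<comment> \<open>The exponent that splits off when the \<open>q\<close>-binomial theorem is applied with \<open>w = ?Q ^ N\<close>; this
    choice of \<open>w\<close> avoids negative powers.\<close>
  define M where "M = k * (N choose 2) + k * N * N + a * N"
  have 2: "2 * int (n choose 2) = int n * (int n - 1)" for n
  proof -
    have "even (n * (n - 1))" by (cases n) auto
    hence "2 * (n choose 2) = n * (n - 1)" by (simp add: choose_two)
    hence "int (2 * (n choose 2)) = int (n * (n - 1))" by (rule arg_cong)
    thus ?thesis by (cases n) (auto simp: algebra_simps)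
  qed
  \<comment> \<open>The comparison of exponents as a polynomial identity over the integers.
    \<open>C\<close>, \<open>D\<close> and \<open>T\<close> stand for two binomials and the theta
    exponent, which are known only through their doubles.\<close>
  have expand: "2 * (K * C + A * S + K * N * R) = 2 * (K * D + K * N * N + A * N + T)"
    if "2 * N = S + R" "2 * T = K * ((S - N) * (S - N - 1)) + 2 * A * (S - N)"
      "2 * C = S * (S - 1)" "2 * D = N * (N - 1)" for K C A S N R D T :: int
  proof -
    have R: "R = 2 * N - S" using that(1) by simp
    have "2 * (K * C + A * S + K * N * R) = K * (2 * C) + 2 * A * S + 2 * K * N * R"
      by (simp add: algebra_simps)
    also have "\<dots> = K * (2 * D) + 2 * K * N * N + 2 * A * N + 2 * T"
      unfolding that(2-4) R by (simp add: algebra_simps)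
    finally show ?thesis by (simp add: algebra_simps)
  qed
  have "(\<Prod>j<2 * N. ?Q ^ N + ?X ^ a * ?Q ^ j) =
      (\<Prod>j<N. ?Q ^ N + ?X ^ a * ?Q ^ j) * (\<Prod>j<N. ?Q ^ N + ?X ^ a * ?Q ^ (N + j))"
    by (simp add: mult_2 prod_lessThan_add)
  also have "(\<Prod>j<N. ?Q ^ N + ?X ^ a * ?Q ^ (N + j)) = ?Q ^ (N * N) * (\<Prod>j<N. 1 + ?X ^ (k * j + a))"
  proof -
    have "?Q ^ N + ?X ^ a * ?Q ^ (N + j) = ?Q ^ N * (1 + ?X ^ (k * j + a))" for j
      by (simp add: algebra_simps power_add flip: power_mult)
    thus ?thesis by (simp add: prod.distrib flip: power_mult)
  qed
  also have "(\<Prod>j<N. ?Q ^ N + ?X ^ a * ?Q ^ j) =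
      ?X ^ (k * (N choose 2) + a * N) * (\<Prod>j<N. 1 + ?X ^ (k * j + (k - a)))"
  proof -
    have "(\<Prod>j<N. ?Q ^ N + ?X ^ a * ?Q ^ j) =
        (\<Prod>j<N. ?X ^ (k * j + a) * (1 + ?X ^ (k * (N - Suc j) + (k - a))))"
    proof (rule prod.cong)
      fix j assume "j \<in> {..<N}"
      hence "N = j + (N - Suc j) + 1" by auto
      hence "k * N = k * j + k * (N - Suc j) + k" by (metis add_mult_distrib2 mult.right_neutral)
      hence "k * N = (k * j + a) + (k * (N - Suc j) + (k - a))" using assms by simp
      thus "?Q ^ N + ?X ^ a * ?Q ^ j =
          ?X ^ (k * j + a) * (1 + ?X ^ (k * (N - Suc j) + (k - a)))"
        by (simp only: flip: power_mult power_add) (simp add: distrib_left add.commute flip: power_add)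
    qed simp
    also have "\<dots> = (\<Prod>j<N. ?X ^ (k * j + a)) * (\<Prod>j<N. 1 + ?X ^ (k * (N - Suc j) + (k - a)))"
      by (rule prod.distrib)
    also have "(\<Prod>j<N. 1 + ?X ^ (k * (N - Suc j) + (k - a))) = (\<Prod>j<N. 1 + ?X ^ (k * j + (k - a)))"
      by (rule prod.nat_diff_reindex)
    also have "(\<Prod>j<N. ?X ^ (k * j + a)) = ?X ^ (\<Sum>j<N. k * j + a)"
      by (simp add: power_sum)
    also have "(\<Sum>j<N. k * j + a) = k * (N choose 2) + a * N"
      by (induction N) (auto simp: numeral_2_eq_2 algebra_simps)
    finally show ?thesis .
  qed
  finally have "(\<Prod>j<2 * N. ?Q ^ N + ?X ^ a * ?Q ^ j) = ?X ^ M * ?L"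
    by (simp add: M_def power_add algebra_simps flip: power_mult)
  moreover have "(\<Prod>j<2 * N. ?Q ^ N + ?X ^ a * ?Q ^ j) = ?X ^ M * ?R"
    unfolding q_binomial_theorem sum_distrib_left
  proof (rule sum.cong)
    fix s assume s: "s \<in> {..2 * N}"
    obtain r where r: "2 * N = s + r" using s le_Suc_ex by auto
    have "2 * int N = int s + int r" using arg_cong [OF r, of int] by simp
    hence "2 * int (k * (s choose 2) + a * s + k * N * r) =
        2 * int (M + theta_exp k a (int s - int N))"
      using double_theta_exp [OF assms, of "int s - int N"] 2 [of s] 2 [of N]
      unfolding M_def of_nat_add of_nat_mult by (rule expand)
    hence "2 * int (k * (s choose 2) + a * s + k * N * (2 * N - s)) =
        2 * int (M + theta_exp k a (int s - int N))"
      using r by simp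
    hence "k * (s choose 2) + a * s + k * N * (2 * N - s) = M + theta_exp k a (int s - int N)"
      by (metis mult_left_cancel of_nat_eq_iff zero_neq_numeral)
    thus "?Q ^ (s choose 2) * qbinom ?Q (2 * N) s * (?X ^ a) ^ s * (?Q ^ N) ^ (2 * N - s) =
        ?X ^ M * (?X ^ theta_exp k a (int s - int N) * qbinom ?Q (2 * N) s)"
      by (simp add: mult_ac flip: power_mult power_add)
  qed simp
  ultimately have "?X ^ M * ?L = ?X ^ M * ?R" by simp
  thus ?thesis by simp
qed

lemma prod_residue_parts:
  assumes "0 < k"
  shows "(\<Prod>j<N. 1 + fps_X ^ (k * j + r)) =
    (\<Prod>i\<in>(\<lambda>j. k * j + r) ` {..<N}. 1 + fps_X ^ i :: 'a::comm_ring_1 fps)"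
  using assms by (subst prod.reindex) (auto simp: inj_on_def)

lemma distinct_prod_residue_parts_agree:
  assumes "0 < k" "0 < r" "n \<le> N"
  shows "fps_agree n (distinct_prod (residue_parts k r)) (\<Prod>j<N. 1 + fps_X ^ (k * j + r))"
  unfolding prod_residue_parts [OF assms(1)]
proof (rule distinct_prod_agree)
  show "residue_parts k r \<inter> {1..n} \<subseteq> (\<lambda>j. k * j + r) ` {..<N}"
  proof
    fix i assume "i \<in> residue_parts k r \<inter> {1..n}"
    then obtain j where j: "i = k * j + r" "k * j + r \<le> n"
      by (auto simp: residue_parts_def)
    have "j \<le> k * j" using assms(1) by simp
    hence "j < N" using j assms by linarith
    thus "i \<in> (\<lambda>j. k * j + r) ` {..<N}" using j by auto
  qed
qed (use assms in \<open>auto simp: residue_parts_def\<close>)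

text \<open>The limit of the finite version after multiplying by the product over the multiples of
  \<open>k\<close>: every Gaussian binomial that matters up to degree \<open>n\<close> is then
  replaced by 1.\<close>

theorem jacobi_triple_product_mod_2:
  assumes "0 < a" "a < k"
  shows "distinct_prod (residue_parts k a) * distinct_prod (residue_parts k (k - a)) *
    distinct_prod (residue_parts k k) = theta k a"
proof (rule fps_ext)
  fix n :: nat
  let ?E = "\<lambda>r. distinct_prod (residue_parts k r)"
  let ?X = "fps_X :: bit fps"
  \<comment> \<open>Exponents at most \<open>n\<close> force \<open>s\<close> to lie within
    \<open>n\<close> of \<open>N\<close>, so this choice makes both \<open>s\<close> and
    \<open>2 * N - s\<close> at least \<open>n\<close>.\<close>
  define N where "N = 2 * n"
  define P where "P = (\<lambda>n. \<Prod>j=1..n. 1 - (?X ^ k) ^ j)"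
  let ?e = "\<lambda>s. theta_exp k a (int s - int N)"
  have P: "fps_agree n (?E k) (P j)" if "n \<le> j" for j
  proof -
    have "P j = (\<Prod>i<j. 1 - (?X ^ k) ^ Suc i)"
      unfolding P_def by (rule prod.reindex_bij_witness [of _ Suc "\<lambda>i. i - 1"]) auto
    also have "\<dots> = (\<Prod>i<j. 1 + ?X ^ (k * i + k))"
    proof (rule prod.cong)
      fix i
      show "1 - (?X ^ k) ^ Suc i = 1 + ?X ^ (k * i + k)"
        unfolding diff_eq_add_bit_fps by (simp add: power_add mult.commute flip: power_mult)
    qed simp
    finally show ?thesis
      using distinct_prod_residue_parts_agree [of k k n j] assms that by simp
  qed
  \<comment> \<open>By the product formula, since all three finite products agree with
    \<open>?E k\<close> up to degree \<open>n\<close> and one factor \<open>?E k\<close>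
    cancels.\<close>
  have qbinom: "fps_agree n (qbinom (?X ^ k) (2 * N) s * ?E k) 1"
    if "n \<le> s" "n \<le> 2 * N - s" "s \<le> 2 * N" for s
  proof (rule fps_agree_cancel)
    have "fps_agree n (qbinom (?X ^ k) (2 * N) s * ?E k * ?E k)
        (qbinom (?X ^ k) (2 * N) s * P s * P (2 * N - s))"
      using that by (intro fps_agree_mult P fps_agree_refl)
    also have "\<dots> = P (2 * N)"
      unfolding P_def using that by (intro qbinom_mult_prods)
    also have "fps_agree n \<dots> (?E k)"
      by (intro fps_agree_sym [OF P]) (simp add: N_def)
    finally show "fps_agree n (qbinom (?X ^ k) (2 * N) s * ?E k * ?E k) (1 * ?E k)"
      by simp
  qed simp
  have "fps_agree n (?E a * ?E (k - a) * ?E k)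
      ((\<Prod>j<N. 1 + ?X ^ (k * j + a)) * (\<Prod>j<N. 1 + ?X ^ (k * j + (k - a))) * ?E k)"
    using assms by (intro fps_agree_mult distinct_prod_residue_parts_agree fps_agree_refl)
      (auto simp: N_def)
  also have "\<dots> = (\<Sum>s\<le>2 * N. ?X ^ ?e s * (qbinom (?X ^ k) (2 * N) s * ?E k))"
    unfolding finite_jacobi_triple_product [OF assms] by (simp add: sum_distrib_right mult.assoc)
  also have "fps_agree n \<dots> (\<Sum>s\<le>2 * N. ?X ^ ?e s * 1)"
  proof (rule fps_agree_sum)
    fix s assume s: "s \<in> {..2 * N}"
    show "fps_agree n (?X ^ ?e s * (qbinom (?X ^ k) (2 * N) s * ?E k)) (?X ^ ?e s * 1)"
    proof (cases "?e s \<le> n")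
      case True
      hence "\<bar>int s - int N\<bar> \<le> int n"
        using abs_le_theta_exp [OF assms, of "int s - int N"] by linarith
      hence "n \<le> s" "n \<le> 2 * N - s" using s by (auto simp: N_def)
      thus ?thesis using s by (intro fps_agree_mult qbinom fps_agree_refl) auto
    next
      case False
      hence "fps_agree n (?X ^ ?e s * f) 0" for f
        by (intro fps_agree_X_power_mult) simp
      thus ?thesis by (meson fps_agree_sym fps_agree_trans)
    qed
  qed
  finally have "(?E a * ?E (k - a) * ?E k) $ n = (\<Sum>s\<le>2 * N. ?X ^ ?e s) $ n"
    by (simp add: fps_agree_def)
  also have "\<dots> = (\<Sum>s\<le>2 * N. if ?e s = n then 1 else 0)"
    by (simp add: fps_sum_nth fps_X_power_nth eq_commute)
  also have "\<dots> = of_nat (card {s \<in> {..2 * N}. ?e s = n})"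
    by (subst sum.inter_filter [symmetric]) auto
  also have "card {s \<in> {..2 * N}. ?e s = n} = card {m. theta_exp k a m = n}"
  proof (rule bij_betw_same_card [of "\<lambda>s. int s - int N"], rule bij_betw_byWitness [where f' = "\<lambda>m. nat (m + int N)"])
    have m: "- int N \<le> m \<and> m \<le> int N" if "m \<in> {m. theta_exp k a m = n}" for m
      using abs_le_theta_exp [OF assms, of m] that by (auto simp: N_def)
    show "\<forall>m\<in>{m. theta_exp k a m = n}. int (nat (m + int N)) - int N = m"
    proof
      fix m assume "m \<in> {m. theta_exp k a m = n}"
      from m [OF this] show "int (nat (m + int N)) - int N = m" by simp
    qed
    show "(\<lambda>m. nat (m + int N)) ` {m. theta_exp k a m = n} \<subseteq> {s \<in> {..2 * N}. ?e s = n}"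
    proof (rule image_subsetI)
      fix m assume "m \<in> {m. theta_exp k a m = n}"
      with m [OF this] show "nat (m + int N) \<in> {s \<in> {..2 * N}. ?e s = n}"
        by (simp add: nat_le_iff)
    qed
  qed auto
  finally show "(?E a * ?E (k - a) * ?E k) $ n = theta k a $ n"
    by (simp add: theta_def)
qed

subsection \<open>Euler products as theta series\<close>

lemma residue_parts_disjoint:
  assumes "r < s" "s < r + k"
  shows "residue_parts k r \<inter> residue_parts k s = {}"
proof (rule ccontr)
  assume "residue_parts k r \<inter> residue_parts k s \<noteq> {}"
  then obtain i j where "k * i + r = k * j + s"
    by (auto simp: residue_parts_def)
  hence "k * i = k * j + (s - r)" using assms by simp
  hence "k dvd s - r" by (metis dvd_add_right_iff dvd_triv_left)
  hence "k \<le> s - r" using assms by (intro dvd_imp_le) auto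
  thus False using assms by linarith
qed

lemma residue_parts_split:
  assumes "0 < m"
  shows "residue_parts d r = (\<Union>i<m. residue_parts (m * d) (d * i + r))"
proof (intro equalityI subsetI)
  fix x assume "x \<in> residue_parts d r"
  then obtain j where j: "x = d * j + r" by (auto simp: residue_parts_def)
  have "m * d * (j div m) + (d * (j mod m) + r) = d * (m * (j div m) + j mod m) + r"
    by (simp only: distrib_left mult_ac add_ac)
  also have "\<dots> = x" using j by simp
  finally have "x \<in> residue_parts (m * d) (d * (j mod m) + r)"
    unfolding residue_parts_def by (metis rangeI)
  thus "x \<in> (\<Union>i<m. residue_parts (m * d) (d * i + r))"
    using assms by (intro UN_I [of "j mod m"]) auto
next
  fix x assume "x \<in> (\<Union>i<m. residue_parts (m * d) (d * i + r))"
  then obtain i j where "x = m * d * j + (d * i + r)" by (auto simp: residue_parts_def)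
  hence "x = d * (m * j + i) + r" by (simp add: algebra_simps)
  thus "x \<in> residue_parts d r" by (auto simp: residue_parts_def)
qed

lemma distinct_prod_residue_parts_split:
  assumes "0 < d" "0 < m"
  shows "distinct_prod (residue_parts d r) =
    (\<Prod>i<m. distinct_prod (residue_parts (m * d) (d * i + r)))"
proof -
  have "distinct_prod (\<Union>i<n. residue_parts (m * d) (d * i + r)) =
      (\<Prod>i<n. distinct_prod (residue_parts (m * d) (d * i + r)))" if "n \<le> m" for n
    using that
  proof (induction n)
    case 0
    show ?case by (simp add: distinct_prod_def fps_eq_iff)
  next
    case (Suc n)
    have "(\<Union>i<n. residue_parts (m * d) (d * i + r)) \<inter> residue_parts (m * d) (d * n + r) = {}"
    proof -
      have "residue_parts (m * d) (d * i + r) \<inter> residue_parts (m * d) (d * n + r) = {}" if "i < n" for i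
      proof (rule residue_parts_disjoint)
        show "d * i + r < d * n + r" using that assms by simp
        have "d * n < m * d" using Suc.prems assms by (simp add: mult.commute)
        thus "d * n + r < d * i + r + m * d" by linarith
      qed
      thus ?thesis by blast
    qed
    moreover have "(\<Union>i<Suc n. residue_parts (m * d) (d * i + r)) =
        (\<Union>i<n. residue_parts (m * d) (d * i + r)) \<union> residue_parts (m * d) (d * n + r)"
      by (auto simp: lessThan_Suc)
    ultimately show ?case using Suc by (simp add: distinct_prod_Un)
  qed
  from this [of m] show ?thesis
    unfolding residue_parts_split [OF assms(2), of d r] by simp
qed

text \<open>The series called \<open>f d\<close> in the overview.\<close>

definition euler_prod :: "nat \<Rightarrow> bit fps" where
  "euler_prod d = distinct_prod (residue_parts d d)"

lemma euler_prod_neq_0 [simp]: "euler_prod d \<noteq> 0"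
  by (simp add: euler_prod_def)

text \<open>Euler's pentagonal number theorem modulo 2, with exponents
  \<open>d * m * (3 * m - 1) / 2\<close>: the triple product for the residues \<open>d\<close>,
  \<open>2 * d\<close>, \<open>3 * d\<close> modulo \<open>3 * d\<close>.\<close>

lemma euler_prod_eq_theta:
  assumes "0 < d"
  shows "euler_prod d = theta (3 * d) d"
proof -
  have "{..<3} = {0, 1, 2::nat}" by auto
  hence "euler_prod d = distinct_prod (residue_parts (3 * d) d) *
      distinct_prod (residue_parts (3 * d) (2 * d)) * distinct_prod (residue_parts (3 * d) (3 * d))"
    unfolding euler_prod_def distinct_prod_residue_parts_split [OF assms, of 3 d, simplified]
    by (simp add: mult_ac flip: mult_2)
  also have "\<dots> = theta (3 * d) d"
    using jacobi_triple_product_mod_2 [of d "3 * d"] assms by simp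
  finally show ?thesis .
qed

lemma square_add_bit_fps: "(f + g) ^ 2 = f ^ 2 + (g :: bit fps) ^ 2"
  by (simp add: power2_sum)

text \<open>The Frobenius map applied to each factor.\<close>

lemma euler_prod_double:
  assumes "0 < d"
  shows "euler_prod (2 * d) = euler_prod d ^ 2"
  unfolding fps_eq_iff_agree
proof
  fix n
  have "fps_agree n (euler_prod (2 * d)) (\<Prod>j<n. 1 + fps_X ^ (2 * d * j + 2 * d))"
    unfolding euler_prod_def using assms by (intro distinct_prod_residue_parts_agree) auto
  also have "\<dots> = (\<Prod>j<n. 1 + fps_X ^ (d * j + d)) * (\<Prod>j<n. 1 + fps_X ^ (d * j + d))"
  proof -
    have "1 + fps_X ^ (2 * d * j + 2 * d) =
        (1 + fps_X ^ (d * j + d)) * (1 + fps_X ^ (d * j + d) :: bit fps)" for j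
      using square_add_bit_fps [of 1 "fps_X ^ (d * j + d)"]
      by (simp add: power2_eq_square algebra_simps flip: power_add)
    thus ?thesis by (simp add: prod.distrib)
  qed
  also have "fps_agree n \<dots> (euler_prod d * euler_prod d)"
    unfolding euler_prod_def using assms
    by (intro fps_agree_mult fps_agree_sym [OF distinct_prod_residue_parts_agree]) auto
  finally show "fps_agree n (euler_prod (2 * d)) (euler_prod d ^ 2)"
    by (simp add: power2_eq_square)
qed

text \<open>Jacobi's identity for the cube, modulo 2. Splitting modulo \<open>4 * d\<close> relates
  the theta series to \<open>f d\<close>, \<open>f (2 * d)\<close> and \<open>f (4 * d)\<close>; the
  last two are the square and fourth power of \<open>f d\<close>.\<close>

lemma euler_prod_cube:
  assumes "0 < d"
  shows "euler_prod d ^ 3 = theta (4 * d) d"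
proof -
  let ?E = "\<lambda>r. distinct_prod (residue_parts (4 * d) r)"
  have four: "{..<4} = {0, 1, 2, 3::nat}" and two: "{..<2} = {0, 1::nat}" by auto
  have 1: "euler_prod d = ?E d * ?E (2 * d) * ?E (3 * d) * ?E (4 * d)"
    unfolding euler_prod_def distinct_prod_residue_parts_split [OF assms, of 4 d, simplified] four
    by (simp add: mult_ac flip: mult_2)
  have 2: "euler_prod (2 * d) = ?E (2 * d) * ?E (4 * d)"
    unfolding euler_prod_def using distinct_prod_residue_parts_split [of "2 * d" 2 "2 * d"] assms
    by (simp add: two mult_ac)
  have "theta (4 * d) d = ?E d * ?E (3 * d) * ?E (4 * d)"
    using jacobi_triple_product_mod_2 [of d "4 * d"] assms by simp
  hence "theta (4 * d) d * euler_prod (2 * d) = euler_prod d * euler_prod (4 * d)"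
    unfolding 1 2 euler_prod_def [of "4 * d"] by (simp add: mult_ac)
  moreover have "euler_prod (4 * d) = euler_prod d ^ 4"
    using euler_prod_double [of "2 * d"] euler_prod_double [of d] assms
    by (simp flip: power_mult)
  ultimately have "theta (4 * d) d * euler_prod d ^ 2 = euler_prod d ^ 3 * euler_prod d ^ 2"
    using euler_prod_double [OF assms] by (simp add: eval_nat_numeral mult_ac)
  thus ?thesis by (subst (asm) mult_right_cancel) simp_all
qed

text \<open>The two triple products take the residues 1, 4 and 2, 3 modulo 5, and each contributes
  the multiples of 5 once.\<close>

lemma theta_5_mult: "theta 5 1 * theta 5 2 = euler_prod 1 * euler_prod 5"
proof -
  let ?E = "\<lambda>r. distinct_prod (residue_parts 5 r)"
  have five: "{..<5} = {0, 1, 2, 3, 4::nat}" by auto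
  have "euler_prod 1 = ?E 1 * ?E 2 * ?E 3 * ?E 4 * ?E 5"
    unfolding euler_prod_def using distinct_prod_residue_parts_split [of 1 5 1]
    by (simp add: five mult_ac eval_nat_numeral)
  moreover have "theta 5 1 = ?E 1 * ?E 4 * ?E 5" "theta 5 2 = ?E 2 * ?E 3 * ?E 5"
    using jacobi_triple_product_mod_2 [of 1 5] jacobi_triple_product_mod_2 [of 2 5] by simp_all
  ultimately show ?thesis
    by (simp add: euler_prod_def mult_ac)
qed

section \<open>Coefficients of squares and of products of theta series\<close>

text \<open>Off-diagonal terms cancel in pairs under \<open>i\<close> to \<open>n - i\<close>; a
  middle term survives only for even \<open>n\<close>, and every bit equals its own square.\<close>

lemma square_nth_bit_fps:
  fixes f :: "bit fps"
  shows "f ^ 2 $ n = (if even n then f $ (n div 2) else 0)"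
proof -
  have sq: "x * x = x" for x :: bit by (cases x) auto
  have dbl: "x + x = 0" for x :: bit by (cases x) auto
  define g where "g = (\<lambda>i. f $ i * f $ (n - i))"
  define L where "L = {i. 2 * i < n}"
  define U where "U = {i. i \<le> n \<and> n < 2 * i}"
  define M where "M = {i. 2 * i = n}"
  have fin: "finite L" "finite U" "finite M"
    unfolding L_def U_def M_def by (rule finite_subset [of _ "{..n}"]; auto)+
  have "f ^ 2 $ n = sum g {..n}"
    by (simp add: power2_eq_square fps_mult_nth g_def atLeast0AtMost)
  also have "{..n} = (L \<union> U) \<union> M" by (auto simp: L_def U_def M_def)
  also have "sum g \<dots> = sum g L + sum g U + sum g M"
  proof -
    have "L \<inter> U = {}" "(L \<union> U) \<inter> M = {}" by (auto simp: L_def U_def M_def)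
    thus ?thesis using fin by (simp add: sum.union_disjoint)
  qed
  also have "sum g U = sum g L"
    by (rule sum.reindex_bij_witness [of _ "\<lambda>i. n - i" "\<lambda>i. n - i"])
      (auto simp: L_def U_def g_def mult.commute)
  also have "sum g L + sum g L + sum g M = sum g M" by (simp only: dbl) simp
  also have "sum g M = (if even n then f $ (n div 2) else 0)"
  proof (cases "even n")
    case True
    hence "M = {n div 2}" by (auto simp: M_def)
    moreover have "n - n div 2 = n div 2" using True by auto
    ultimately show ?thesis using True by (simp add: g_def sq)
  next
    case False
    hence "M = {}" by (auto simp: M_def)
    thus ?thesis using False by simp
  qed
  finally show ?thesis .
qed

lemma theta_mult_nth:
  assumes "0 < a" "a < k" "0 < c" "c < l"
  shows "(theta k a * theta l c) $ n =
    of_nat (card {(m, m'). theta_exp k a m + theta_exp l c m' = n})"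
proof -
  let ?A = "\<lambda>i. {m. theta_exp k a m = i}" and ?B = "\<lambda>i. {m. theta_exp l c m = i}"
  have "(theta k a * theta l c) $ n = of_nat (\<Sum>i\<in>{0..n}. card (?A i) * card (?B (n - i)))"
    by (simp add: fps_mult_nth theta_def)
  also have "(\<Sum>i\<in>{0..n}. card (?A i) * card (?B (n - i))) = (\<Sum>i\<in>{0..n}. card (?A i \<times> ?B (n - i)))"
    by (simp add: card_cartesian_product)
  also have "\<dots> = card (\<Union>i\<in>{0..n}. ?A i \<times> ?B (n - i))"
    using finite_theta_exp [OF assms(1,2)] finite_theta_exp [OF assms(3,4)]
    by (intro card_UN_disjoint [symmetric]) auto
  also have "(\<Union>i\<in>{0..n}. ?A i \<times> ?B (n - i)) = {(m, m'). theta_exp k a m + theta_exp l c m' = n}"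
    by auto
  finally show ?thesis .
qed

text \<open>The sixth power is the square of a theta series, so its exponents are
  \<open>d * 2 * m * (2 * m - 1)\<close>. Each number \<open>j * (j + 1)\<close> equals
  \<open>2 * m * (2 * m - 1)\<close> for exactly one integer \<open>m\<close>.\<close>

lemma euler_prod_power_6_nth:
  assumes "0 < d"
  shows "euler_prod d ^ 6 $ n = of_bool (\<exists>j::nat. n = d * (j * (j + 1)))"
proof -
  have "euler_prod d ^ 6 = theta (4 * d) d ^ 2"
    unfolding euler_prod_cube [OF assms, symmetric] by (simp flip: power_mult)
  hence 1: "euler_prod d ^ 6 $ n = (if even n then theta (4 * d) d $ (n div 2) else 0)"
    by (simp add: square_nth_bit_fps)
  show ?thesis
  proof (cases "even n")
    case False
    moreover have "even (d * (j * (j + 1)))" for j by simp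
    ultimately show ?thesis using 1 by auto
  next
    case True
    have e: "theta_exp (4 * d) d m = n div 2 \<longleftrightarrow> int n = int d * (2 * m * (2 * m - 1))" for m
    proof -
      have "2 * int (theta_exp (4 * d) d m) = int d * (2 * m * (2 * m - 1))"
        using double_theta_exp [of d "4 * d" m] assms by (simp add: algebra_simps)
      moreover have "2 * int (n div 2) = int n" using True by auto
      ultimately show ?thesis by linarith
    qed
    let ?M = "{m. int n = int d * (2 * m * (2 * m - 1))}"
    have "euler_prod d ^ 6 $ n = of_nat (card ?M)"
      using 1 True by (simp add: theta_def e)
    also have "card ?M = of_bool (\<exists>j::nat. n = d * (j * (j + 1)))"
    proof (cases "\<exists>j::nat. n = d * (j * (j + 1))")
      case True
      then obtain j :: nat where j: "n = d * (j * (j + 1))" by blast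
      \<comment> \<open>\<open>2 * m\<close> is whichever of \<open>- j\<close> and
        \<open>j + 1\<close> is even.\<close>
      define m where "m = (if even j then - int (j div 2) else int ((j + 1) div 2))"
      have "2 * m * (2 * m - 1) = int j * (int j + 1)"
      proof (cases "even j")
        case True
        hence "2 * m = - int j" by (auto simp: m_def)
        thus ?thesis by (simp add: algebra_simps)
      next
        case False
        hence "2 * m = int j + 1" by (auto simp: m_def elim!: oddE)
        thus ?thesis by (simp add: algebra_simps)
      qed
      hence m: "int n = int d * (2 * m * (2 * m - 1))"
        by (simp only: j of_nat_mult of_nat_add of_nat_1)
      have "?M = {m}"
      proof (intro equalityI subsetI)
        fix m' assume "m' \<in> ?M"
        hence "2 * m' * (2 * m' - 1) = 2 * m * (2 * m - 1)" using m assms by simp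
        hence "(m' - m) * (2 * (m' + m) - 1) = 0" by (simp add: algebra_simps)
        moreover have "2 * (m' + m) - 1 \<noteq> 0" by presburger
        ultimately show "m' \<in> {m}" by simp
      qed (use m in auto)
      thus ?thesis using True by simp
    next
      case False
      have "?M = {}"
      proof (rule ccontr)
        assume "?M \<noteq> {}"
        then obtain m where m: "int n = int d * (2 * m * (2 * m - 1))" by blast
        define j where "j = nat (if m > 0 then 2 * m - 1 else - 2 * m)"
        have "int j * (int j + 1) = 2 * m * (2 * m - 1)"
          by (auto simp: j_def algebra_simps)
        hence "int n = int (d * (j * (j + 1)))"
          using m by (simp only: of_nat_mult of_nat_add of_nat_1)
        thus False using False by (metis of_nat_eq_iff)
      qed
      thus ?thesis using False by simp
    qed
    finally show ?thesis by simp
  qed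
qed

text \<open>Representations of \<open>n\<close> as a sum of two triangular numbers with indices in
  all integers, so \<open>x\<close> and \<open>- 1 - x\<close> give the same triangular number. The
  congruence selects those coming from \<open>theta 5 1 * theta 5 2\<close>.\<close>

definition triangular_pairs :: "nat \<Rightarrow> (int \<times> int) set" where
  "triangular_pairs n = {(x, y). x * (x + 1) + y * (y + 1) = 2 * int n \<and> 5 dvd x - 2 * y}"

lemma finite_triangular_pairs: "finite (triangular_pairs n)"
proof (rule finite_subset)
  have nonneg: "0 \<le> t * (t + 1)" for t :: int
    by (cases "0 \<le> t") (auto intro: mult_nonpos_nonpos)
  have bound: "\<bar>t\<bar> \<le> t * (t + 1) + 1" for t :: int
  proof (cases "0 \<le> t")
    case True
    thus ?thesis using mult_nonneg_nonneg [of t t] by (simp add: algebra_simps)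
  next
    case False
    hence "0 \<le> (- t - 1) * (- t - 1)" by (intro mult_nonneg_nonneg) auto
    thus ?thesis using False by (simp add: algebra_simps)
  qed
  have "\<bar>x\<bar> \<le> 2 * int n + 1 \<and> \<bar>y\<bar> \<le> 2 * int n + 1" if "x * (x + 1) + y * (y + 1) = 2 * int n" for x y
    using that nonneg [of x] nonneg [of y] bound [of x] bound [of y] by linarith
  thus "triangular_pairs n \<subseteq> {- (2 * int n + 1)..2 * int n + 1} \<times> {- (2 * int n + 1)..2 * int n + 1}"
    by (fastforce simp: triangular_pairs_def abs_le_iff)
qed auto

text \<open>The substitution \<open>x = l - 2 * m\<close>, \<open>y = - m - 2 * l\<close> turns the
  doubled exponent into \<open>x * (x + 1) + y * (y + 1)\<close>. Its image is exactly the lattice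
  \<open>5 dvd x - 2 * y\<close>.\<close>

lemma theta_5_mult_nth: "(theta 5 1 * theta 5 2) $ n = of_nat (card (triangular_pairs n))"
proof -
  have eq: "theta_exp 5 1 m + theta_exp 5 2 l = n \<longleftrightarrow> 5 * m * m - 3 * m + 5 * l * l - l = 2 * int n" for m l
  proof -
    have "2 * int (theta_exp 5 1 m + theta_exp 5 2 l) = 5 * m * m - 3 * m + 5 * l * l - l"
      using double_theta_exp [of 1 5 m] double_theta_exp [of 2 5 l] by (simp add: algebra_simps)
    thus ?thesis by (metis mult_left_cancel of_nat_eq_iff zero_neq_numeral)
  qed
  let ?g = "\<lambda>(m, l). (l - 2 * m, - m - 2 * l) :: int \<times> int"
  have img: "triangular_pairs n = ?g ` {(m, l). theta_exp 5 1 m + theta_exp 5 2 l = n}"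
  proof (intro equalityI subsetI)
    fix z assume "z \<in> triangular_pairs n"
    then obtain x y where z: "z = (x, y)" and xy: "x * (x + 1) + y * (y + 1) = 2 * int n"
      "5 dvd x - 2 * y"
      by (auto simp: triangular_pairs_def)
    from xy(2) obtain l where l: "x - 2 * y = 5 * l" by (elim dvdE)
    define m where "m = - y - 2 * l"
    have "x = l - 2 * m" "y = - m - 2 * l" using l by (simp_all add: m_def)
    with xy(1) z show "z \<in> ?g ` {(m, l). theta_exp 5 1 m + theta_exp 5 2 l = n}"
      unfolding eq by (auto simp: algebra_simps intro!: image_eqI [of _ _ "(m, l)"])
  next
    fix z assume "z \<in> ?g ` {(m, l). theta_exp 5 1 m + theta_exp 5 2 l = n}"
    thus "z \<in> triangular_pairs n"
      unfolding eq by (auto simp: triangular_pairs_def algebra_simps)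
  qed
  have "card (triangular_pairs n) = card {(m, l). theta_exp 5 1 m + theta_exp 5 2 l = n}"
    unfolding img by (rule card_image) (auto simp: inj_on_def)
  thus ?thesis using theta_mult_nth [of 1 5 2 5 n] by simp
qed

subsection \<open>Pairs of triangular numbers modulo 2\<close>

lemma of_nat_bit_eq: "(of_nat n :: bit) = of_bool (odd n)"
  by (induction n) auto

lemma of_nat_card_involution_bit:
  assumes "finite A" "\<And>x. x \<in> A \<Longrightarrow> h x \<in> A" "\<And>x. x \<in> A \<Longrightarrow> h (h x) = x"
  shows "(of_nat (card A) :: bit) = of_nat (card {x \<in> A. h x = x})"
proof -
  let ?F = "{x \<in> A. h x = x}"
  have "(\<Sum>x\<in>A - ?F. 1 :: bit) = 0"
    by (rule sum_involution_eq_0 [where h = h]) (use assms in auto)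
  hence "(of_nat (card (A - ?F)) :: bit) = 0" by simp
  moreover have "card A = card (A - ?F) + card ?F"
    using assms(1) by (metis (no_types, lifting) add.commute card_Diff_subset card_mono finite_subset le_add_diff_inverse mem_Collect_eq subsetI)
  ultimately show ?thesis by simp
qed

text \<open>Modulo 5, inserting \<open>x = 2 * y\<close> makes the left side of the equation
  \<open>3 * y\<close>, that is \<open>- 2 * y\<close>.\<close>

lemma triangular_pairs_mod_5:
  assumes "(x, y) \<in> triangular_pairs n"
  shows "5 dvd y + int n"
proof -
  from assms have eq: "x * (x + 1) + y * (y + 1) = 2 * int n" and "5 dvd x - 2 * y"
    by (auto simp: triangular_pairs_def)
  then obtain k where "x - 2 * y = 5 * k" by (elim dvdE)
  hence x: "x = 2 * y + 5 * k" by simp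
  have "2 * (y + int n) = 5 * (y * y + y + 4 * y * k + 5 * k * k + k)"
    using eq unfolding x by (simp add: algebra_simps)
  hence "5 dvd 2 * (y + int n)" by simp
  thus ?thesis by presburger
qed

lemma pronic_eq_iff: "x * (x + 1) = y * (y + 1) \<longleftrightarrow> x = y \<or> x = - 1 - y" for x y :: int
proof -
  have "x * (x + 1) - y * (y + 1) = (x - y) * (x + y + 1)" by (simp add: algebra_simps)
  hence "x * (x + 1) = y * (y + 1) \<longleftrightarrow> (x - y) * (x + y + 1) = 0" by linarith
  thus ?thesis by auto
qed

text \<open>Parity is counted on the fixed points of an involution built from the swap and the
  reflections \<open>t\<close> to \<open>- 1 - t\<close>. A single reflection has no integer fixed
  point; the swap and the reflected swap fix solutions of \<open>y * (y + 1) = n\<close>. If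
  \<open>n\<close> is 1 modulo 5, then \<open>y\<close> is 4 and \<open>x\<close> is 3 modulo 5, and
  no such symmetry but the identity preserves that class.\<close>

lemma card_triangular_pairs_not_1_mod_5:
  assumes "n mod 5 \<noteq> 1"
  shows "(of_nat (card (triangular_pairs n)) :: bit) = of_bool (\<exists>j::nat. n = j * (j + 1))"
proof -
  let ?W = "triangular_pairs n"
  \<comment> \<open>Since \<open>y\<close> is determined modulo 5 by \<open>n\<close>, a single one of these symmetries acts on the
    whole set.\<close>
  define h where "h = (\<lambda>(x, y). if y mod 5 = 0 then (y, x) else if y mod 5 = 1 then (- 1 - x, y)
    else if y mod 5 = 2 then (x, - 1 - y) else (- 1 - y, - 1 - x :: int))"
  have cases: "y mod 5 = 0 \<and> x mod 5 = 0 \<or> y mod 5 = 1 \<and> x mod 5 = 2 \<or>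
      y mod 5 = 2 \<and> x mod 5 = 4 \<or> y mod 5 = 3 \<and> x mod 5 = 1" if "(x, y) \<in> ?W" for x y
  proof -
    have "5 dvd y + int n" "5 dvd x - 2 * y"
      using triangular_pairs_mod_5 [OF that] that by (auto simp: triangular_pairs_def)
    moreover have "int n mod 5 \<noteq> 1" using assms by presburger
    ultimately show ?thesis by presburger
  qed
  have flip: "(- 1 - x) * (- 1 - x + 1) = x * (x + 1)" for x :: int by (simp add: algebra_simps)
  have hW: "h (x, y) \<in> ?W \<and> h (h (x, y)) = (x, y)" if W: "(x, y) \<in> ?W" for x y
  proof -
    have eq: "x * (x + 1) + y * (y + 1) = 2 * int n" using W by (simp add: triangular_pairs_def)
    hence eq': "y * (y + 1) + x * (x + 1) = 2 * int n" by simp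
    from cases [OF W] consider
      "y mod 5 = 0" "x mod 5 = 0" | "y mod 5 = 1" "x mod 5 = 2" |
      "y mod 5 = 2" "x mod 5 = 4" | "y mod 5 = 3" "x mod 5 = 1" by blast
    thus ?thesis
    proof cases
      case 1
      have "5 dvd y - 2 * x" using 1 by presburger
      hence "(y, x) \<in> ?W" using eq by (simp add: triangular_pairs_def add.commute)
      moreover have "h (x, y) = (y, x)" "h (y, x) = (x, y)" using 1 by (simp_all add: h_def)
      ultimately show ?thesis by simp
    next
      case 2
      have "5 dvd (- 1 - x) - 2 * y" using 2 by presburger
      hence "(- 1 - x, y) \<in> ?W"
        unfolding triangular_pairs_def using eq by (simp only: mem_Collect_eq prod.case flip)
      moreover have "h (x, y) = (- 1 - x, y)" "h (- 1 - x, y) = (x, y)"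
        using 2 by (simp_all add: h_def)
      ultimately show ?thesis by simp
    next
      case 3
      have "5 dvd x - 2 * (- 1 - y)" "(- 1 - y) mod 5 = 2" using 3 by presburger+
      hence "(x, - 1 - y) \<in> ?W"
        unfolding triangular_pairs_def using eq by (simp only: mem_Collect_eq prod.case flip)
      moreover have "h (x, y) = (x, - 1 - y)" "h (x, - 1 - y) = (x, y)"
        using 3 \<open>(- 1 - y) mod 5 = 2\<close> by (simp_all add: h_def)
      ultimately show ?thesis by simp
    next
      case 4
      have "5 dvd (- 1 - y) - 2 * (- 1 - x)" "(- 1 - x) mod 5 = 3" using 4 by presburger+
      hence "(- 1 - y, - 1 - x) \<in> ?W"
        unfolding triangular_pairs_def using eq'
        by (simp only: mem_Collect_eq prod.case flip)
      moreover have "h (x, y) = (- 1 - y, - 1 - x)" "h (- 1 - y, - 1 - x) = (x, y)"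
        using 4 \<open>(- 1 - x) mod 5 = 3\<close> by (simp_all add: h_def)
      ultimately show ?thesis by simp
    qed
  qed
  let ?F = "{z \<in> ?W. h z = z}"
  have "(of_nat (card ?W) :: bit) = of_nat (card ?F)"
    by (rule of_nat_card_involution_bit) (use hW finite_triangular_pairs in auto)
  also have "card ?F = of_bool (\<exists>j::nat. n = j * (j + 1))"
  proof -
    have F: "(x, y) \<in> ?F \<longleftrightarrow> y * (y + 1) = int n \<and> (y mod 5 = 0 \<and> x = y \<or> y mod 5 = 3 \<and> x = - 1 - y)" for x y
    proof
      assume xy: "(x, y) \<in> ?F"
      hence W: "(x, y) \<in> ?W" and h: "h (x, y) = (x, y)" by auto
      from cases [OF W] have "y mod 5 = 0 \<and> x = y \<or> y mod 5 = 3 \<and> x = - 1 - y"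
      proof (elim disjE conjE)
        assume "y mod 5 = 1"
        hence "- 1 - x = x" using h by (simp add: h_def)
        hence False by presburger
        thus ?thesis ..
      next
        assume "y mod 5 = 2"
        hence "- 1 - y = y" using h by (simp add: h_def)
        hence False by presburger
        thus ?thesis ..
      next
        assume "y mod 5 = 0"
        hence "h (x, y) = (y, x)" by (simp add: h_def)
        hence "x = y" using h by (metis prod.inject)
        thus ?thesis using \<open>y mod 5 = 0\<close> by blast
      next
        assume "y mod 5 = 3"
        hence "h (x, y) = (- 1 - y, - 1 - x)" by (simp add: h_def)
        hence "x = - 1 - y" using h by (metis prod.inject)
        thus ?thesis using \<open>y mod 5 = 3\<close> by blast
      qed
      moreover from this have "x * (x + 1) = y * (y + 1)" unfolding pronic_eq_iff by blast
      hence "y * (y + 1) = int n" using W by (simp add: triangular_pairs_def)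
      ultimately show "y * (y + 1) = int n \<and> (y mod 5 = 0 \<and> x = y \<or> y mod 5 = 3 \<and> x = - 1 - y)"
        by blast
    next
      assume xy: "y * (y + 1) = int n \<and> (y mod 5 = 0 \<and> x = y \<or> y mod 5 = 3 \<and> x = - 1 - y)"
      hence "x * (x + 1) = y * (y + 1)" unfolding pronic_eq_iff by blast
      moreover have d: "y mod 5 = 0 \<and> x = y \<or> y mod 5 = 3 \<and> x = - 1 - y" using xy by blast
      hence "5 dvd x - 2 * y"
      proof (elim disjE conjE)
        assume "y mod 5 = 3" "x = - 1 - y"
        moreover have "- 1 - y - 2 * y = - 1 - 3 * y" by simp
        ultimately show ?thesis by presburger
      next
        assume "y mod 5 = 0" "x = y"
        thus ?thesis by (simp add: mod_eq_0_iff_dvd)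
      qed
      moreover have "h (x, y) = (x, y)" using d by (auto simp: h_def)
      ultimately show "(x, y) \<in> ?F" using xy by (simp add: triangular_pairs_def)
    qed
    show ?thesis
    proof (cases "\<exists>j::nat. n = j * (j + 1)")
      case True
      then obtain j :: nat where j: "n = j * (j + 1)" by blast
      have jn: "int n = int j * (int j + 1)" by (simp only: j of_nat_mult of_nat_add of_nat_1)
      \<comment> \<open>The residue 2 would make \<open>n\<close> congruent to 6, hence to
        1.\<close>
      have "int j mod 5 \<noteq> 2"
      proof
        assume "int j mod 5 = 2"
        then obtain k where "int j = 5 * k + 2" by (metis mult_div_mod_eq)
        hence "int n = 5 * (5 * k * k + 5 * k + 1) + 1" using jn by (simp add: algebra_simps)
        then obtain q where "int n = 5 * q + 1" by blast
        thus False using assms by presburger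
      qed
      \<comment> \<open>Of the two roots \<open>j\<close> and \<open>- 1 - j\<close>, exactly one
        has residue 0 or 3 modulo 5, which makes the fixed point unique.\<close>
      define y where "y = (if int j mod 5 = 0 \<or> int j mod 5 = 3 then int j else - 1 - int j)"
      define x where "x = (if y mod 5 = 0 then y else - 1 - y)"
      have ymod: "y mod 5 = 0 \<or> y mod 5 = 3"
        using \<open>int j mod 5 \<noteq> 2\<close> unfolding y_def by presburger
      have yn: "y * (y + 1) = int n" unfolding jn pronic_eq_iff by (simp add: y_def)
      have "?F = {(x, y)}"
      proof (intro equalityI subsetI)
        fix z assume z: "z \<in> ?F"
        obtain x' y' where z': "z = (x', y')" by force
        have F': "y' * (y' + 1) = int n" "y' mod 5 = 0 \<and> x' = y' \<or> y' mod 5 = 3 \<and> x' = - 1 - y'"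
          using z F [of x' y'] unfolding z' by blast+
        have "y' = y \<or> y' = - 1 - y" using F'(1) yn pronic_eq_iff [of y' y] by simp
        moreover have "(- 1 - y) mod 5 \<noteq> 0 \<and> (- 1 - y) mod 5 \<noteq> 3" using ymod by presburger
        moreover have "y' mod 5 = 0 \<or> y' mod 5 = 3" using F'(2) by blast
        ultimately have "y' = y" by metis
        moreover have "x' = x" using F'(2) \<open>y' = y\<close> by (auto simp: x_def)
        ultimately show "z \<in> {(x, y)}" using z' by simp
      next
        fix z assume "z \<in> {(x, y)}"
        moreover have "(x, y) \<in> ?F" unfolding F using yn ymod by (auto simp: x_def)
        ultimately show "z \<in> ?F" by blast
      qed
      thus ?thesis using True by simp
    next
      case False
      have "(x, y) \<notin> ?F" for x y
      proof
        assume "(x, y) \<in> ?F"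
        hence y: "y * (y + 1) = int n" using F by blast
        define j where "j = nat (if y \<ge> 0 then y else - 1 - y)"
        have "int j * (int j + 1) = y * (y + 1)" unfolding pronic_eq_iff by (simp add: j_def)
        hence "int n = int (j * (j + 1))" using y by (simp only: of_nat_mult of_nat_add of_nat_1)
        thus False using False by (metis of_nat_eq_iff)
      qed
      hence "?F = {}" by auto
      moreover have "of_bool (\<exists>j::nat. n = j * (j + 1)) = (0 :: nat)"
        using False by (simp only: of_bool_eq_0_iff) simp
      ultimately show ?thesis by (simp only: card.empty)
    qed
  qed
  finally show ?thesis by simp
qed

lemma card_triangular_pairs_descent: "card (triangular_pairs (5 * n + 1)) = card (triangular_pairs n)"
proof -
  \<comment> \<open>Multiplication of \<open>(2 * x + 1) + (2 * y + 1) * \<i>\<close> by \<open>- 2 + \<i>\<close>, a Gaussian integer of norm 5.\<close>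
  let ?g = "\<lambda>(x, y). (- 2 * x - y - 2, x - 2 * y - 1) :: int \<times> int"
  have "triangular_pairs (5 * n + 1) = ?g ` triangular_pairs n"
  proof (intro equalityI subsetI)
    fix z assume z: "z \<in> triangular_pairs (5 * n + 1)"
    obtain x y where xy: "z = (x, y)" by force
    have eq: "x * (x + 1) + y * (y + 1) = 2 * int (5 * n + 1)" and d: "5 dvd x - 2 * y"
      using z by (auto simp: xy triangular_pairs_def)
    \<comment> \<open>For surjectivity: here \<open>y\<close> is 4 and \<open>x\<close> is 3 modulo
      5, which makes division by the Gaussian integer exact.\<close>
    have "5 dvd y + int (5 * n + 1)" using z unfolding xy by (rule triangular_pairs_mod_5)
    hence "5 dvd y + 1" by presburger
    moreover from this have "5 dvd x + 2" using d by presburger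
    ultimately obtain s t where "x + 2 = 5 * s" "y + 1 = 5 * t" by (elim dvdE)
    hence st: "x = 5 * s - 2" "y = 5 * t - 1" by simp_all
    have "(t - 2 * s, - s - 2 * t) \<in> triangular_pairs n"
      using eq unfolding st by (simp add: triangular_pairs_def algebra_simps)
    moreover have "z = ?g (t - 2 * s, - s - 2 * t)" by (simp add: xy st)
    ultimately show "z \<in> ?g ` triangular_pairs n" by (rule rev_image_eqI)
  next
    fix z assume "z \<in> ?g ` triangular_pairs n"
    then obtain x y where xy: "z = ?g (x, y)" "x * (x + 1) + y * (y + 1) = 2 * int n" "5 dvd x - 2 * y"
      by (auto simp: triangular_pairs_def)
    have "5 dvd (- 2 * x - y - 2) - 2 * (x - 2 * y - 1)" using xy(3) by presburger
    thus "z \<in> triangular_pairs (5 * n + 1)"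
      using xy(1,2) by (simp add: triangular_pairs_def algebra_simps)
  qed
  moreover have "inj_on ?g (triangular_pairs n)" by (auto simp: inj_on_def)
  ultimately show ?thesis by (simp add: card_image)
qed

text \<open>For \<open>n = 5 * k + 1\<close> the descent preserves the count, while the two
  conditions on \<open>n\<close> become the same two on \<open>k\<close> in exchanged order, by
  \<open>j = 5 * i + 2\<close>. Otherwise the second condition fails.\<close>

lemma card_triangular_pairs_bit:
  "(of_nat (card (triangular_pairs n)) :: bit) =
    of_bool (\<exists>j::nat. n = j * (j + 1)) + of_bool (\<exists>j::nat. n = 1 + 5 * (j * (j + 1)))"
proof (induction n rule: less_induct)
  case (less n)
  show ?case
  proof (cases "n mod 5 = 1")
    case False
    hence "\<nexists>j::nat. n = 1 + 5 * (j * (j + 1))" by auto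
    thus ?thesis using card_triangular_pairs_not_1_mod_5 [OF False] by simp
  next
    case True
    define k where "k = n div 5"
    have n: "n = 5 * k + 1" using True unfolding k_def by presburger
    have "(\<exists>j::nat. n = j * (j + 1)) \<longleftrightarrow> (\<exists>j::nat. k = 1 + 5 * (j * (j + 1)))"
    proof
      assume "\<exists>j::nat. n = j * (j + 1)"
      then obtain j :: nat where j: "n = j * (j + 1)" by blast
      define i where "i = j div 5"
      have "j mod 5 = 0 \<or> j mod 5 = 1 \<or> j mod 5 = 2 \<or> j mod 5 = 3 \<or> j mod 5 = 4" by presburger
      \<comment> \<open>Among the five residues only 2 satisfies this congruence.\<close>
      moreover have "(j mod 5 * (j mod 5 + 1)) mod 5 = 1"
        using True unfolding j by (metis mod_add_left_eq mod_mult_eq mod_mod_trivial)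
      ultimately have "j mod 5 = 2" by (elim disjE) simp_all
      hence "j = 5 * i + 2" unfolding i_def by presburger
      define m where "m = 1 + 5 * (i * (i + 1))"
      have "5 * k + 1 = 5 * m + 1"
        using j n \<open>j = 5 * i + 2\<close> by (simp add: m_def algebra_simps)
      hence "k = 1 + 5 * (i * (i + 1))" by (simp add: m_def)
      thus "\<exists>j::nat. k = 1 + 5 * (j * (j + 1))" ..
    next
      assume "\<exists>j::nat. k = 1 + 5 * (j * (j + 1))"
      then obtain j :: nat where "k = 1 + 5 * (j * (j + 1))" by blast
      hence "n = (5 * j + 2) * ((5 * j + 2) + 1)" using n by (simp add: algebra_simps)
      thus "\<exists>j::nat. n = j * (j + 1)" by blast
    qed
    moreover have "(\<exists>j::nat. n = 1 + 5 * (j * (j + 1))) \<longleftrightarrow> (\<exists>j::nat. k = j * (j + 1))"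
    proof -
      have "n = 1 + 5 * m \<longleftrightarrow> k = m" for m using n by auto
      thus ?thesis by (simp only:)
    qed
    moreover have "card (triangular_pairs n) = card (triangular_pairs k)"
      unfolding n by (rule card_triangular_pairs_descent)
    ultimately show ?thesis using less.IH [of k] n by (simp add: add.commute)
  qed
qed

theorem euler_prod_1_5:
  "euler_prod 1 * euler_prod 5 = euler_prod 1 ^ 6 + fps_X * euler_prod 5 ^ 6"
proof (rule fps_ext)
  fix n
  have "(euler_prod 1 * euler_prod 5) $ n =
      of_bool (\<exists>j::nat. n = j * (j + 1)) + of_bool (\<exists>j::nat. n = 1 + 5 * (j * (j + 1)))"
    unfolding theta_5_mult [symmetric] theta_5_mult_nth card_triangular_pairs_bit ..
  moreover have "(fps_X * euler_prod 5 ^ 6) $ n = of_bool (\<exists>j::nat. n = 1 + 5 * (j * (j + 1)))"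
    by (cases n) (simp_all add: euler_prod_power_6_nth)
  moreover have "euler_prod 1 ^ 6 $ n = of_bool (\<exists>j::nat. n = j * (j + 1))"
    by (simp add: euler_prod_power_6_nth)
  ultimately show "(euler_prod 1 * euler_prod 5) $ n = (euler_prod 1 ^ 6 + fps_X * euler_prod 5 ^ 6) $ n"
    unfolding fps_add_nth by simp
qed

subsection \<open>Partitions\<close>

definition partitions_with :: "nat set \<Rightarrow> nat \<Rightarrow> nat multiset set" where
  "partitions_with S n = {M. set_mset M \<subseteq> S \<and> sum_mset M = n}"

lemma finite_partitions_with:
  assumes "finite S" "0 \<notin> S"
  shows "finite (partitions_with S n)"
proof (rule finite_subset)
  show "partitions_with S n \<subseteq> mset ` {xs. set xs \<subseteq> S \<and> length xs \<le> n}"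
  proof
    fix M assume "M \<in> partitions_with S n"
    hence M: "set_mset M \<subseteq> S" "sum_mset M = n" by (auto simp: partitions_with_def)
    obtain xs where xs: "M = mset xs" by (metis ex_mset)
    have "length ys \<le> sum_list ys" if "0 \<notin> set ys" for ys :: "nat list"
      using that by (induction ys) auto
    hence "length xs \<le> n"
      using M xs assms(2) by (metis set_mset_mset subsetD sum_mset_sum_list)
    thus "M \<in> mset ` {xs. set xs \<subseteq> S \<and> length xs \<le> n}"
      using M xs by auto
  qed
  show "finite (mset ` {xs. set xs \<subseteq> S \<and> length xs \<le> n})"
    using assms(1) by (intro finite_imageI finite_lists_length_le)
qed

definition partitions_fps :: "nat set \<Rightarrow> 'a::comm_ring_1 fps" where
  "partitions_fps S = Abs_fps (\<lambda>n. of_nat (card (partitions_with S n)))"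

text \<open>Partitions are sorted by whether \<open>j\<close> occurs; if it does, one copy is
  removed.\<close>

lemma partitions_fps_insert:
  assumes "finite S" "0 \<notin> S" "0 < j" "j \<notin> S"
  shows "partitions_fps (insert j S) = partitions_fps S + fps_X ^ j * partitions_fps (insert j S)"
proof (rule fps_ext)
  fix n
  have "card (partitions_with (insert j S) n) =
      card (partitions_with S n) + (if n < j then 0 else card (partitions_with (insert j S) (n - j)))"
  proof -
    let ?A = "if n < j then {} else add_mset j ` partitions_with (insert j S) (n - j)"
    have "partitions_with (insert j S) n = partitions_with S n \<union> ?A"
    proof (intro equalityI subsetI)
      fix M assume M: "M \<in> partitions_with (insert j S) n"
      show "M \<in> partitions_with S n \<union> ?A"
      proof (cases "j \<in># M")
        case True
        then obtain M' where M': "M = add_mset j M'" by (metis mset_add)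
        hence "M' \<in> partitions_with (insert j S) (n - j)" "\<not> n < j"
          using M by (auto simp: partitions_with_def)
        thus ?thesis using M' by auto
      next
        case False
        thus ?thesis using M by (auto simp: partitions_with_def)
      qed
    next
      fix M assume "M \<in> partitions_with S n \<union> ?A"
      then consider "M \<in> partitions_with S n" | M' where "\<not> n < j" "M = add_mset j M'"
        "M' \<in> partitions_with (insert j S) (n - j)"
        by (auto split: if_splits)
      thus "M \<in> partitions_with (insert j S) n"
      proof cases
        case 1
        thus ?thesis by (auto simp: partitions_with_def)
      next
        case 2
        from 2(3) have M': "set_mset M' \<subseteq> insert j S" "sum_mset M' = n - j"
          unfolding partitions_with_def by blast+
        have "sum_mset M = n" using 2(1) M'(2) unfolding 2(2) by simp
        moreover have "set_mset M \<subseteq> insert j S" using M'(1) unfolding 2(2) by simp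
        ultimately show ?thesis by (simp add: partitions_with_def)
      qed
    qed
    moreover have "partitions_with S n \<inter> ?A = {}"
    proof -
      have "j \<in># M" if "M \<in> ?A" for M
        using that by (auto split: if_splits)
      moreover have "j \<notin># M" if "M \<in> partitions_with S n" for M
        using that assms(4) unfolding partitions_with_def by blast
      ultimately show ?thesis by blast
    qed
    moreover have "finite (partitions_with S n)" "finite ?A"
      using assms by (auto intro!: finite_partitions_with)
    moreover have "card ?A = (if n < j then 0 else card (partitions_with (insert j S) (n - j)))"
      by (simp add: card_image inj_on_def)
    ultimately show ?thesis by (simp add: card_Un_disjoint)
  qed
  thus "partitions_fps (insert j S) $ n =
      (partitions_fps S + fps_X ^ j * partitions_fps (insert j S)) $ n"
    by (simp add: partitions_fps_def fps_X_power_mult_nth)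
qed

lemma partitions_fps_mult_prod:
  assumes "finite S" "0 \<notin> S"
  shows "partitions_fps S * (\<Prod>j\<in>S. 1 - fps_X ^ j) = (1 :: 'a::comm_ring_1 fps)"
  using assms
proof (induction S rule: finite_induct)
  case empty
  have "partitions_with {} n = (if n = 0 then {{#}} else {})" for n
    by (auto simp: partitions_with_def)
  thus ?case by (simp add: partitions_fps_def fps_eq_iff)
next
  case (insert j S)
  have "partitions_fps (insert j S) * (1 - fps_X ^ j) = (partitions_fps S :: 'a fps)"
    using partitions_fps_insert [of S j, where 'a = 'a] insert by (simp add: algebra_simps)
  hence "partitions_fps (insert j S) * ((1 - fps_X ^ j) * (\<Prod>j\<in>S. 1 - fps_X ^ j)) =
      (partitions_fps S :: 'a fps) * (\<Prod>j\<in>S. 1 - fps_X ^ j)"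
    by (simp flip: mult.assoc)
  thus ?case using insert by simp
qed

definition regular_fps :: "nat \<Rightarrow> bit fps" where
  "regular_fps ell = Abs_fps (\<lambda>n. of_nat (b ell n))"

text \<open>Up to degree \<open>n\<close> only parts at most \<open>n\<close> occur, so the identity
  for finite sets of parts applies.\<close>

lemma regular_fps_mult: "regular_fps ell * distinct_prod {j. 0 < j \<and> \<not> ell dvd j} = 1"
  unfolding fps_eq_iff_agree
proof
  fix n
  let ?S = "{j. 0 < j \<and> \<not> ell dvd j} \<inter> {1..n}"
  have "b ell i = card (partitions_with ?S i)" if "i \<le> n" for i
  proof -
    have "(\<forall>x\<in>#M. 0 < x \<and> \<not> ell dvd x) \<and> sum_mset M = i \<longleftrightarrow> set_mset M \<subseteq> ?S \<and> sum_mset M = i" for M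
    proof -
      have "x \<le> n" if "x \<in># M" "sum_mset M = i" for x
        using sum_mset.remove [OF that(1)] that(2) \<open>i \<le> n\<close> by simp
      thus ?thesis by auto
    qed
    thus ?thesis unfolding b_def partitions_with_def by presburger
  qed
  hence "fps_agree n (regular_fps ell) (partitions_fps ?S)"
    by (simp add: fps_agree_def regular_fps_def partitions_fps_def)
  moreover have "fps_agree n (distinct_prod {j. 0 < j \<and> \<not> ell dvd j}) (\<Prod>j\<in>?S. 1 + fps_X ^ j)"
    by (rule distinct_prod_agree) auto
  ultimately have "fps_agree n (regular_fps ell * distinct_prod {j. 0 < j \<and> \<not> ell dvd j})
      (partitions_fps ?S * (\<Prod>j\<in>?S. 1 + fps_X ^ j))"
    by (rule fps_agree_mult)
  also have "\<dots> = 1"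
    using partitions_fps_mult_prod [of ?S, where 'a = bit] by (simp add: diff_eq_add_bit_fps)
  finally show "fps_agree n (regular_fps ell * distinct_prod {j. 0 < j \<and> \<not> ell dvd j}) 1" .
qed

lemma regular_fps_5_mult: "regular_fps 5 * euler_prod 1 = euler_prod 5"
proof -
  have "residue_parts 1 1 = {j. 0 < j \<and> \<not> 5 dvd j} \<union> residue_parts 5 5"
  proof (intro equalityI subsetI)
    fix x assume "x \<in> residue_parts 1 1"
    hence "0 < x" by (auto simp: residue_parts_def)
    show "x \<in> {j. 0 < j \<and> \<not> 5 dvd j} \<union> residue_parts 5 5"
    proof (cases "5 dvd x")
      case True
      then obtain k where "x = 5 * k" by (elim dvdE)
      hence "x = 5 * (k - 1) + 5" using \<open>0 < x\<close> by (cases k) auto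
      thus ?thesis unfolding residue_parts_def by blast
    qed (use \<open>0 < x\<close> in simp)
  next
    fix x assume "x \<in> {j. 0 < j \<and> \<not> 5 dvd j} \<union> residue_parts 5 5"
    hence "x = 1 * (x - 1) + 1" by (auto simp: residue_parts_def)
    thus "x \<in> residue_parts 1 1" unfolding residue_parts_def by blast
  qed
  moreover have "{j. 0 < j \<and> \<not> 5 dvd j} \<inter> residue_parts 5 5 = {}"
    by (auto simp: residue_parts_def)
  ultimately have "euler_prod 1 = distinct_prod {j. 0 < j \<and> \<not> 5 dvd j} * euler_prod 5"
    unfolding euler_prod_def by (simp only: distinct_prod_Un)
  thus ?thesis using regular_fps_mult [of 5] by (simp flip: mult.assoc)
qed

section \<open>Extraction of the exponents congruent to 1 modulo 4\<close>

lemma power_4_nth_bit_fps: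
  fixes f :: "bit fps"
  shows "f ^ 4 $ n = (if 4 dvd n then f $ (n div 4) else 0)"
proof -
  have "f ^ 4 = (f ^ 2) ^ 2" by (simp flip: power_mult)
  hence "f ^ 4 $ n = (if even n then f ^ 2 $ (n div 2) else 0)"
    by (simp only: square_nth_bit_fps)
  also have "\<dots> = (if even n \<and> even (n div 2) then f $ (n div 2 div 2) else 0)"
    by (simp only: square_nth_bit_fps) simp
  also have "even n \<and> even (n div 2) \<longleftrightarrow> 4 dvd n" by presburger
  also have "n div 2 div 2 = n div 4" by presburger
  finally show ?thesis .
qed

text \<open>The three terms are fourth powers times \<open>1\<close>, \<open>X\<close> and
  \<open>X ^ 3\<close>, so their exponents lie in the classes 0, 1 and 3 modulo 4.\<close>

lemma regular_fps_5_quartic: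
  "regular_fps 5 = euler_prod 1 ^ 4 + fps_X * (euler_prod 5 * euler_prod 1 ^ 2) ^ 4 +
    fps_X ^ 3 * (euler_prod 5 ^ 3 * regular_fps 5) ^ 4"
proof -
  let ?B = "regular_fps 5" and ?u = "euler_prod 1" and ?v = "euler_prod 5" and ?X = "fps_X :: bit fps"
  have "?B * ?u ^ 2 = ?v * ?u"
    using regular_fps_5_mult by (simp add: power2_eq_square flip: mult.assoc)
  also have "\<dots> = ?u ^ 6 + ?X * ?v ^ 6"
    using euler_prod_1_5 by (simp add: mult.commute)
  \<comment> \<open>Trading \<open>?v ^ 2\<close> for \<open>(?B * ?u) ^ 2\<close> makes
    \<open>?u ^ 2\<close> a common factor that cancels.\<close>
  also have "?v ^ 6 = ?v ^ 4 * (?B * ?u) ^ 2"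
    unfolding regular_fps_5_mult by (simp flip: power_add)
  also have "?u ^ 6 + ?X * (?v ^ 4 * (?B * ?u) ^ 2) = (?u ^ 4 + ?X * ?v ^ 4 * ?B ^ 2) * ?u ^ 2"
  proof -
    have "?u ^ 6 = ?u ^ 4 * ?u ^ 2" by (simp flip: power_add)
    thus ?thesis by (simp add: distrib_left distrib_right power_mult_distrib mult_ac)
  qed
  finally have B: "?B = ?u ^ 4 + ?X * ?v ^ 4 * ?B ^ 2"
    by (subst (asm) mult_right_cancel) simp_all
  \<comment> \<open>Squaring is additive here, so the square of \<open>B\<close> expresses
    \<open>?B ^ 2\<close> through \<open>?B ^ 4\<close>. The equation is applied by
    \<open>arg_cong\<close> because \<open>?B\<close> occurs on both of its sides.\<close>
  have "?B ^ 2 = (?u ^ 4 + ?X * ?v ^ 4 * ?B ^ 2) ^ 2"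
    by (rule arg_cong [OF B])
  also have "\<dots> = ?u ^ 8 + ?X ^ 2 * ?v ^ 8 * ?B ^ 4"
    unfolding square_add_bit_fps by (simp add: power_mult_distrib flip: power_mult)
  finally have "?B ^ 2 = ?u ^ 8 + ?X ^ 2 * ?v ^ 8 * ?B ^ 4" .
  hence "?u ^ 4 + ?X * ?v ^ 4 * ?B ^ 2 = ?u ^ 4 + ?X * ?v ^ 4 * (?u ^ 8 + ?X ^ 2 * ?v ^ 8 * ?B ^ 4)"
    by (rule arg_cong)
  also have "\<dots> = ?u ^ 4 + ?X * (?v * ?u ^ 2) ^ 4 + ?X ^ 3 * (?v ^ 3 * ?B) ^ 4"
  proof -
    have "?v ^ 4 * ?v ^ 8 = ?v ^ 12" by (simp flip: power_add)
    moreover have "?X * ?X ^ 2 = ?X ^ 3" by (simp add: eval_nat_numeral)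
    ultimately show ?thesis
      by (simp add: distrib_left power_mult_distrib mult_ac flip: power_mult)
  qed
  finally show ?thesis by (rule trans [OF B])
qed

lemma b_5_bit: "(of_nat (b 5 (4 * n + 1)) :: bit) = (euler_prod 5 * euler_prod 2) $ n"
proof -
  have "of_nat (b 5 (4 * n + 1)) = regular_fps 5 $ (4 * n + 1)"
    by (simp add: regular_fps_def)
  also have "\<dots> = (euler_prod 1 ^ 4) $ (4 * n + 1) +
      (fps_X * (euler_prod 5 * euler_prod 1 ^ 2) ^ 4) $ (4 * n + 1) +
      (fps_X ^ 3 * (euler_prod 5 ^ 3 * regular_fps 5) ^ 4) $ (4 * n + 1)"
    by (subst regular_fps_5_quartic) (simp only: fps_add_nth)
  also have "(euler_prod 1 ^ 4) $ (4 * n + 1) = 0"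
  proof -
    have "\<not> 4 dvd 4 * n + 1" by presburger
    thus ?thesis by (simp only: power_4_nth_bit_fps if_False)
  qed
  also have "(fps_X * (euler_prod 5 * euler_prod 1 ^ 2) ^ 4) $ (4 * n + 1) =
      (euler_prod 5 * euler_prod 1 ^ 2) $ n"
    by (simp add: power_4_nth_bit_fps)
  also have "(fps_X ^ 3 * (euler_prod 5 ^ 3 * regular_fps 5) ^ 4) $ (4 * n + 1) = 0"
  \<comment> \<open>For \<open>n = 0\<close> the degree 1 is below 3; otherwise the remaining degree
    is 2 modulo 4.\<close>
  proof (cases n)
    case (Suc k)
    hence "4 * n + 1 - 3 = 4 * k + 2" by simp
    moreover have "\<not> 4 dvd 4 * k + 2" by presburger
    ultimately show ?thesis
      unfolding fps_X_power_mult_nth power_4_nth_bit_fps by presburger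
  qed (simp add: fps_X_power_mult_nth)
  finally show ?thesis
    using euler_prod_double [of 1] by simp
qed

section \<open>Representations by the form \<open>5 * x ^ 2 + 2 * y ^ 2\<close>\<close>

text \<open>Completing the square in the pentagonal exponents, with
  \<open>x = 6 * m - 1\<close>.\<close>

lemma euler_prod_nth_neq_0D:
  assumes "0 < d" "euler_prod d $ n \<noteq> 0"
  shows "\<exists>x. 24 * int n + int d = int d * x ^ 2"
proof -
  from assms have "of_nat (card {m. theta_exp (3 * d) d m = n}) \<noteq> (0 :: bit)"
    unfolding euler_prod_eq_theta [OF assms(1)] by (simp add: theta_def)
  hence "{m. theta_exp (3 * d) d m = n} \<noteq> {}" by force
  then obtain m where "theta_exp (3 * d) d m = n" by blast
  hence "2 * int n = int d * (3 * m * m - m)"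
    using double_theta_exp [of d "3 * d" m] assms(1) by (simp add: algebra_simps)
  hence "12 * (2 * int n) + int d = int d * (6 * m - 1) ^ 2"
    by (simp add: power2_eq_square algebra_simps)
  thus ?thesis by auto
qed

lemma b_5_odd_imp_representable:
  assumes "odd (b 5 (4 * n + 1))"
  shows "\<exists>x y. 24 * int n + 7 = 5 * x ^ 2 + 2 * y ^ 2"
proof -
  have "(euler_prod 5 * euler_prod 2) $ n \<noteq> 0"
    using assms by (simp add: of_nat_bit_eq flip: b_5_bit)
  then obtain i where i: "i \<le> n" "euler_prod 5 $ i * euler_prod 2 $ (n - i) \<noteq> 0"
    unfolding fps_mult_nth by (metis (no_types, lifting) atLeastAtMost_iff sum.neutral)
  hence "euler_prod 5 $ i \<noteq> 0" "euler_prod 2 $ (n - i) \<noteq> 0" by (metis mult_zero_left, metis mult_zero_right)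
  then obtain x y where "24 * int i + 5 = 5 * x ^ 2" "24 * int (n - i) + 2 = 2 * y ^ 2"
    using euler_prod_nth_neq_0D [of 5 i] euler_prod_nth_neq_0D [of 2 "n - i"] by auto
  hence "24 * int n + 7 = 5 * x ^ 2 + 2 * y ^ 2" using i(1) by (simp add: of_nat_diff)
  thus ?thesis by blast
qed

text \<open>If \<open>x\<close> were invertible modulo \<open>p\<close>, with inverse
  \<open>t\<close>, then twice the form times \<open>t ^ 2\<close> would exhibit \<open>- 10\<close>
  as the square of \<open>2 * y * t\<close>.\<close>

lemma prime_dvd_form_imp_dvd:
  fixes p x y :: int
  assumes p: "prime p" and nonres: "\<not> QuadRes p (- 10)" and "\<not> p dvd 2" and dvd: "p dvd 5 * x ^ 2 + 2 * y ^ 2"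
  shows "p dvd x \<and> p dvd y"
proof -
  have "p dvd x"
  proof (rule ccontr)
    assume "\<not> p dvd x"
    hence "coprime x p" using p by (metis coprime_commute prime_imp_coprime)
    then obtain t where t: "[x * t = 1] (mod p)" using cong_solve_coprime_int by blast
    have "p dvd 2 * t ^ 2 * (5 * x ^ 2 + 2 * y ^ 2)" using dvd by simp
    also have "2 * t ^ 2 * (5 * x ^ 2 + 2 * y ^ 2) = (2 * y * t) ^ 2 + 10 * (x * t) ^ 2"
      by (simp add: power2_eq_square algebra_simps)
    finally have "[(2 * y * t) ^ 2 = - (10 * (x * t) ^ 2)] (mod p)"
      by (simp add: cong_iff_dvd_diff)
    moreover have "[- (10 * (x * t) ^ 2) = - (10 * 1 ^ 2)] (mod p)"
      using t by (intro cong_minus_minus_iff [THEN iffD2] cong_mult cong_pow) auto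
    ultimately have "[(2 * y * t) ^ 2 = - 10] (mod p)" using cong_trans by fastforce
    thus False using nonres unfolding QuadRes_def by blast
  qed
  hence "p dvd 2 * y ^ 2" using dvd by (metis dvd_add_right_iff dvd_mult dvd_power zero_less_numeral dvd_trans)
  hence "p dvd y" using p assms(3) by (metis prime_dvd_mult_iff prime_dvd_power)
  with \<open>p dvd x\<close> show ?thesis ..
qed

text \<open>Descent: \<open>p\<close> divides both variables, so \<open>p ^ 2\<close> can be
  removed. An odd exponent finally leaves a single \<open>p\<close>, and the second factor
  \<open>p\<close> must come from \<open>c\<close>.\<close>

lemma odd_prime_power_mult_form_imp_dvd:
  fixes p x y c :: int
  assumes p: "prime p" and nonres: "\<not> QuadRes p (- 10)" and "\<not> p dvd 2"
    and "5 * x ^ 2 + 2 * y ^ 2 = p ^ (2 * k + 1) * c"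
  shows "p dvd c"
  using assms(4)
proof (induction k arbitrary: x y)
  case (0 x y)
  have "p dvd x \<and> p dvd y"
    using 0 by (intro prime_dvd_form_imp_dvd assms) auto
  then obtain u v where "x = p * u" "y = p * v" by (auto elim!: dvdE)
  hence "p * (p * (5 * u ^ 2 + 2 * v ^ 2)) = p * c"
    using 0 by (simp add: power2_eq_square algebra_simps)
  hence "p * (5 * u ^ 2 + 2 * v ^ 2) = c" using p by (metis mult_left_cancel not_prime_0)
  thus ?case by auto
next
  case (Suc k x y)
  have "p dvd x \<and> p dvd y"
    using Suc.prems by (intro prime_dvd_form_imp_dvd assms) auto
  then obtain u v where "x = p * u" "y = p * v" by (auto elim!: dvdE)
  hence "p ^ 2 * (5 * u ^ 2 + 2 * v ^ 2) = p ^ 2 * (p ^ (2 * k + 1) * c)"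
    using Suc.prems by (simp add: power2_eq_square algebra_simps)
  hence "5 * u ^ 2 + 2 * v ^ 2 = p ^ (2 * k + 1) * c"
    using p by (metis mult_left_cancel not_prime_0 power_not_zero)
  thus ?case by (rule Suc.IH)
qed

section \<open>The arithmetic progression\<close>

lemma prime_square_mod_24:
  fixes p :: nat
  assumes "prime p" "p \<ge> 5"
  shows "[p ^ 2 = 1] (mod 24)"
proof -
  have "\<not> 2 dvd p" "\<not> 3 dvd p"
    using assms by (auto simp: prime_nat_iff)
  hence "p mod 24 = 1 \<or> p mod 24 = 5 \<or> p mod 24 = 7 \<or> p mod 24 = 11 \<or>
      p mod 24 = 13 \<or> p mod 24 = 17 \<or> p mod 24 = 19 \<or> p mod 24 = 23"
    by presburger
  moreover have "p ^ 2 mod 24 = (p mod 24) ^ 2 mod 24" by (simp add: power_mod)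
  ultimately show ?thesis by (auto simp: cong_def)
qed

theorem theorem3p17:
  fixes p :: nat
  assumes "prime p" and "p \<ge> 5" and "Legendre (-10) (int p) = -1"
  shows "\<forall>\<alpha>::nat. \<forall>n::nat. \<forall>i::nat. 1 \<le> \<alpha> \<longrightarrow> 1 \<le> i \<longrightarrow> i \<le> p - 1 \<longrightarrow>
    even (b 5 (4 * p ^ (2 * \<alpha>) * n + ((24 * i + 7 * p) * p ^ (2 * \<alpha> - 1) - 1) div 6))"
proof (intro allI impI)
  fix \<alpha> n i :: nat
  assume "1 \<le> \<alpha>" and i: "1 \<le> i" "i \<le> p - 1"
  then obtain a where a: "\<alpha> = Suc a" by (cases \<alpha>) auto
  define q where "q = p ^ (2 * a + 1)"
  have q: "p ^ (2 * \<alpha> - 1) = q" "p ^ (2 * \<alpha>) = p * q" by (simp_all add: a q_def)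
  have "[(p ^ 2) ^ \<alpha> = 1 ^ \<alpha>] (mod 24)"
    using assms by (intro cong_pow prime_square_mod_24)
  moreover have "(p ^ 2) ^ \<alpha> = p * q" using q(2) by (simp add: power_mult)
  ultimately have "(p * q) mod 24 = 1" by (simp add: cong_def)
  then obtain k where k: "p * q = 24 * k + 1" by (metis mult_div_mod_eq)
  \<comment> \<open>Chosen so that the argument of \<open>b 5\<close> is \<open>4 * N + 1\<close>;
    the summand \<open>7 * k\<close> comes from \<open>7 * (p * q) = 168 * k + 7\<close>.\<close>
  define N where "N = p * q * n + i * q + 7 * k"
  have "(24 * i + 7 * p) * q - 1 = 24 * (i * q) + 7 * (p * q) - 1"
    by (simp add: algebra_simps)
  also have "\<dots> = 6 * (4 * (i * q + 7 * k) + 1)" unfolding k by simp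
  finally have quot: "((24 * i + 7 * p) * q - 1) div 6 = 4 * (i * q + 7 * k) + 1" by simp
  have arg: "4 * p ^ (2 * \<alpha>) * n + ((24 * i + 7 * p) * p ^ (2 * \<alpha> - 1) - 1) div 6 = 4 * N + 1"
    unfolding q quot N_def by (simp add: algebra_simps)
  have "24 * N + 7 = q * (24 * p * n + 24 * i + 7 * p)"
  proof -
    have "24 * N + 7 = 24 * (p * q * n + i * q) + 7 * (24 * k + 1)"
      by (simp add: N_def)
    also have "7 * (24 * k + 1) = 7 * (p * q)" unfolding k ..
    finally show ?thesis by (simp add: algebra_simps)
  qed
  hence N: "24 * int N + 7 = int p ^ (2 * a + 1) * int (24 * p * n + 24 * i + 7 * p)"
    unfolding q_def by (metis of_nat_add of_nat_mult of_nat_numeral of_nat_power)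
  have "\<not> QuadRes (int p) (- 10)"
    using assms(3) by (auto simp: Legendre_def split: if_splits)
  moreover have "\<not> int p dvd 2"
    using assms(2) by (auto dest: zdvd_imp_le)
  \<comment> \<open>Thus \<open>p\<close> occurs in \<open>24 * N + 7\<close> exactly to the odd
    power \<open>2 * a + 1\<close>. The range of \<open>i\<close> enters here, since
    \<open>p\<close> would otherwise divide \<open>i\<close>.\<close>
  moreover have "\<not> int p dvd int (24 * p * n + 24 * i + 7 * p)"
  proof
    assume "int p dvd int (24 * p * n + 24 * i + 7 * p)"
    hence "p dvd 24 * p * n + 24 * i + 7 * p" by (simp only: int_dvd_int_iff)
    hence "p dvd 24 * i" by (simp add: dvd_add_left_iff dvd_add_right_iff)
    moreover have "coprime p 24"
    proof -
      have "\<not> p dvd 2" "\<not> p dvd 3" using assms(2) by (auto dest: dvd_imp_le)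
      hence "coprime p 2" "coprime p 3" using assms(1) prime_imp_coprime by blast+
      hence "coprime p (2 * 2 * 2 * 3)" by (simp only: coprime_mult_right_iff)
      thus ?thesis by simp
    qed
    ultimately have "p dvd i" by (simp add: coprime_dvd_mult_right_iff)
    thus False using i assms(2) by (auto dest: dvd_imp_le)
  qed
  ultimately have "\<nexists>x y. 24 * int N + 7 = 5 * x ^ 2 + 2 * y ^ 2"
    using odd_prime_power_mult_form_imp_dvd [of "int p"] assms(1) N by (metis prime_nat_int_transfer)
  thus "even (b 5 (4 * p ^ (2 * \<alpha>) * n + ((24 * i + 7 * p) * p ^ (2 * \<alpha> - 1) - 1) div 6))"
    unfolding arg using b_5_odd_imp_representable by blast
qed

end
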